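(* Let $D$ be a non-commutative division ring with center $F$, let $K$ be a proper division subring of $D$ with $F\subseteq K$, and let $N$ be a normal subgroup of the multiplicative group $D^*$. If $N$ is radical over $K$, then $N\setminus K$ does not contain any Kurosh element of $D$.
   Context: $D^*=D\setminus\{0\}$ is the multiplicative group of $D$. An element $x\in D$ is radical over a subring $K$ of $D$ if there is a positive integer $n_x$ (depending on $x$) such that $x^{n_x}\in K$; a subset of $D$ is radical over $K$ if all its elements are. A division ring is centrally finite if it is a finite dimensional vector space over its center. An element of $D$ is non-central if it is not in the center $F$ of $D$. A non-central element $x$ of $D$ is called Kurosh if there exists a centrally finite division subring $D_1$ of $D$ such that $x\in D_1$ and $x$ is not in the center of $D_1$. *)

theory Defs
  imports "HOL-Algebra.Embedded_Algebras"
begin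

text \<open>The name avoids a clash with the type class \<open>division_ring\<close> of Main. This is the locale
  \<open>field\<close> of HOL-Algebra without commutativity.\<close>

locale skew_field = ring +
  assumes one_not_zero [simp]: "\<one> \<noteq> \<zero>"
    and skew_field_Units: "Units R = carrier R - {\<zero>}"

definition division_subring :: "'a set \<Rightarrow> ('a, 'b) ring_scheme \<Rightarrow> bool" where
  "division_subring K R \<longleftrightarrow> subring K R \<and> skew_field (R\<lparr>carrier := K\<rparr>)"

definition ring_center :: "('a, 'b) ring_scheme \<Rightarrow> 'a set" where
  "ring_center R = {z \<in> carrier R. \<forall>y \<in> carrier R. z \<otimes>\<^bsub>R\<^esub> y = y \<otimes>\<^bsub>R\<^esub> z}"

text \<open>\<open>finite_dimension\<close> is meaningful only over a subfield; \<open>ring_center_subfield\<close> below shows that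
  the center of a division ring is one.\<close>

definition centrally_finite :: "('a, 'b) ring_scheme \<Rightarrow> bool" where
  "centrally_finite R \<longleftrightarrow> skew_field R \<and> ring.finite_dimension R (ring_center R) (carrier R)"

definition radical_over :: "('a, 'b) ring_scheme \<Rightarrow> 'a set \<Rightarrow> 'a set \<Rightarrow> bool" where
  "radical_over R S K \<longleftrightarrow> (\<forall>x \<in> S. \<exists>n::nat. n > 0 \<and> x [^]\<^bsub>R\<^esub> n \<in> K)"

definition kurosh :: "('a, 'b) ring_scheme \<Rightarrow> 'a \<Rightarrow> bool" where
  "kurosh R x \<longleftrightarrow> x \<in> carrier R \<and> x \<notin> ring_center R \<and>
     (\<exists>D1. division_subring D1 R \<and> centrally_finite (R\<lparr>carrier := D1\<rparr>) \<and>
           x \<in> D1 \<and> x \<notin> ring_center (R\<lparr>carrier := D1\<rparr>))"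

lemma (in skew_field) ring_center_subfield: "subfield (ring_center R) R"
proof (rule subfieldI)
  have I: "z \<in> ring_center R"
    if "z \<in> carrier R" "\<And>y. y \<in> carrier R \<Longrightarrow> z \<otimes> y = y \<otimes> z" for z
    using that unfolding ring_center_def by blast
  have C: "z \<in> carrier R" if "z \<in> ring_center R" for z
    using that unfolding ring_center_def by blast
  have E: "z \<otimes> y = y \<otimes> z" if "z \<in> ring_center R" "y \<in> carrier R" for z y
    using that unfolding ring_center_def by blast
  have "subring (ring_center R) R"
  proof (rule subringI)
    show "ring_center R \<subseteq> carrier R" using C by blast
    show "\<one> \<in> ring_center R" by (rule I) simp_all
    fix h assume h: "h \<in> ring_center R"
    show "\<ominus> h \<in> ring_center R"
      using C[OF h] E[OF h] by (intro I) (simp_all add: l_minus r_minus)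
    fix k assume k: "k \<in> ring_center R"
    have "h \<otimes> k \<otimes> y = y \<otimes> (h \<otimes> k)" if y: "y \<in> carrier R" for y
    proof -
      have "h \<otimes> k \<otimes> y = h \<otimes> y \<otimes> k"
        using C[OF h] C[OF k] E[OF k y] y by (simp add: m_assoc)
      then show ?thesis unfolding E[OF h y] using C[OF h] C[OF k] y by (simp add: m_assoc)
    qed
    then show "h \<otimes> k \<in> ring_center R" using C[OF h] C[OF k] by (intro I) simp_all
    have "(h \<oplus> k) \<otimes> y = y \<otimes> (h \<oplus> k)" if y: "y \<in> carrier R" for y
      unfolding l_distr[OF C[OF h] C[OF k] y] r_distr[OF C[OF h] C[OF k] y]
        E[OF h y] E[OF k y] ..
    then show "h \<oplus> k \<in> ring_center R" using C[OF h] C[OF k] by (intro I) simp_all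
  qed
  then show "subcring (ring_center R) R"
    by (rule subcringI) (use C E in blast)
  have inv: "inv z \<in> ring_center R" "inv z \<otimes> z = \<one>" "z \<otimes> inv z = \<one>"
    if z: "z \<in> ring_center R" "z \<noteq> \<zero>" for z
  proof -
    have zU: "z \<in> Units R" using C[OF z(1)] z(2) skew_field_Units by blast
    then show "inv z \<otimes> z = \<one>" "z \<otimes> inv z = \<one>" by simp_all
    have "inv z \<otimes> y = y \<otimes> inv z" if y: "y \<in> carrier R" for y
    proof -
      have "inv z \<otimes> y = inv z \<otimes> (y \<otimes> z) \<otimes> inv z"
        using zU C[OF z(1)] y by (simp add: m_assoc)
      also have "\<dots> = inv z \<otimes> z \<otimes> y \<otimes> inv z"
        unfolding E[OF z(1) y, symmetric] using zU C[OF z(1)] y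
        by (simp only: m_assoc Units_inv_closed m_closed)
      also have "\<dots> = y \<otimes> inv z" using zU y by simp
      finally show ?thesis .
    qed
    then show "inv z \<in> ring_center R" using zU by (intro I) simp_all
  qed
  have "\<zero> \<otimes> x \<noteq> \<one>" if "x \<in> ring_center R" for x
    using C[OF that] one_not_zero l_null by metis
  then show "Units (R\<lparr>carrier := ring_center R\<rparr>) = ring_center R - {\<zero>}"
    using inv unfolding Units_def by simp blast
qed

end

theory Submission
  imports Defs "Jordan_Normal_Form.Determinant"
begin

text \<open>Let $x \in N$ lie in a centrally finite division subring $D_1$. The claim is that $x$ is central in
$D_1$, which excludes every Kurosh element.

\<^emph>\<open>From $K$ to commuting powers\<close> (\<open>radical_imp_locally_radical\<close>). For $a \notin K$ and $x \in N$ choose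
$n$ so large that $X = x^n$, $Y = (a x a^{-1})^n$ and $Z = ((a+1) x (a+1)^{-1})^n$ all lie in $K$.
Then $a X = Y a$ and $(a + 1) X = Z (a + 1)$, so $Y a + X = Z a + Z$. As $a \notin K$, this forces
$Y = Z = X$, and $X$ commutes with $a$. An element of $K$ is the difference of two elements outside
$K$, so for every $d \in D$ some power of $x$ commutes with $d$. Applied to a basis of $D_1$ over its
center, this shows that $N \cap D_1$ is a normal subgroup of $D_1^*$ that is radical over the center.

\<^emph>\<open>Such a subgroup is central\<close> (\<open>radical_normal_central\<close>). Write $D$ for $D_1$.
The determinant of left multiplication over the center is trivial on commutators, and on a
central $z$ it is a power of $z$; so a commutator that has a central power is a root of unity
(\<open>commutator_torsion\<close>). If $N$ were not central it would contain a noncentral commutator $e$, which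
is then a root of unity. Conjugation by $e$ is diagonalizable over the field generated by $e$, hence
there is an $a \neq 0$ with $a e = e^i a \neq e a$ (\<open>eigenvector\<close>). All commutators
$[e, v]$ are roots of unity.

The contradiction comes from a congruence argument in the ring $A = \mathbb{Z}[e, a]$. If $I$ is an
ideal of $A$ containing $v = r a$, then $w = [e, 1 + v]$ is congruent to $1$ modulo $I$ up to central
denominators congruent to $1$; a nontrivial root of unity of this kind forces a prime number that
is nonzero in $D$ into $I$ (\<open>unipotent_torsion\<close>). In characteristic $0$ the ideal $4A$ gives $1 \in 2A$, and
likewise $1 \in 2 \mathbb{Z}[e, a^{-1}]$. Chevalley's argument for the existence of valuations shows
that these two cannot hold together (\<open>two_not_unit\<close>). In characteristic $p$ the ideal $A a$ gives
$a^{-1} \in A$, and by symmetry $a \in \mathbb{Z}[e, a^{-1}]$; then $A$ is finite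
(\<open>finite_if_pole\<close>), and the relation $a e = e^i a \neq e a$ contradicts Wedderburn's theorem on
finite division rings (\<open>finite_twisted_commute\<close>).

The second part is proved for types of class \<open>division_ring\<close>. It is carried over to rings given
by a carrier set through a type whose elements are the elements of a hypothetical counterexample
(\<open>centrally_finite_radical\<close>).\<close>

section \<open>Commutators with a central power\<close>

definition cent :: "'a::ring_1 set" where
  "cent = {z. \<forall>y. z * y = y * z}"

lemma centD: "z \<in> cent \<Longrightarrow> z * y = y * z"
  by (simp add: cent_def)

text \<open>The center as a type of class \<open>field\<close>, so that vector spaces and determinants over it are available.\<close>

typedef (overloaded) 'a centre = "cent :: 'a::division_ring set"
  by (rule exI[of _ 0]) (simp add: cent_def)

setup_lifting type_definition_centre

instantiation centre :: (division_ring) field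
begin

lift_definition zero_centre :: "'a centre" is 0 by (simp add: cent_def)
lift_definition one_centre :: "'a centre" is 1 by (simp add: cent_def)
lift_definition plus_centre :: "'a centre \<Rightarrow> 'a centre \<Rightarrow> 'a centre" is "(+)"
  by (simp add: cent_def algebra_simps)
lift_definition uminus_centre :: "'a centre \<Rightarrow> 'a centre" is uminus
  by (simp add: cent_def)
lift_definition minus_centre :: "'a centre \<Rightarrow> 'a centre \<Rightarrow> 'a centre" is "(-)"
  by (simp add: cent_def algebra_simps)
lift_definition times_centre :: "'a centre \<Rightarrow> 'a centre \<Rightarrow> 'a centre" is "(*)"
proof -
  fix x z :: 'a assume "x \<in> cent" "z \<in> cent"
  then have "x * z * y = y * (x * z)" for y
    using centD[of x y] centD[of z y] by (metis mult.assoc)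
  then show "x * z \<in> cent" by (simp add: cent_def)
qed
lift_definition inverse_centre :: "'a centre \<Rightarrow> 'a centre" is inverse
proof -
  fix z :: 'a assume z: "z \<in> cent"
  show "inverse z \<in> cent"
  proof (cases "z = 0")
    case False
    have "inverse z * y = y * inverse z" for y
    proof -
      have "inverse z * y = inverse z * (y * z) * inverse z"
        using False by (simp add: mult.assoc)
      also have "\<dots> = inverse z * (z * y) * inverse z" using centD[OF z] by simp
      also have "\<dots> = y * inverse z" using False by (simp flip: mult.assoc)
      finally show ?thesis .
    qed
    then show ?thesis by (simp add: cent_def)
  qed (simp add: cent_def)
qed
definition divide_centre :: "'a centre \<Rightarrow> 'a centre \<Rightarrow> 'a centre" where
  "divide_centre x y = x * inverse y"

instance
proof
  fix a b c :: "'a centre"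
  show "a * b * c = a * (b * c)" by transfer (simp add: mult.assoc)
  show "a * b = b * a" by transfer (simp add: centD)
  show "1 * a = a" by transfer simp
  show "a + b + c = a + (b + c)" by transfer (simp add: add.assoc)
  show "a + b = b + a" by transfer (simp add: add.commute)
  show "0 + a = a" by transfer simp
  show "- a + a = 0" by transfer simp
  show "a - b = a + - b" by transfer simp
  show "(a + b) * c = a * c + b * c" by transfer (simp add: distrib_right)
  show "(0::'a centre) \<noteq> 1" by transfer simp
  show "inverse (0::'a centre) = 0" by transfer simp
  show "a div b = a * inverse b" by (simp add: divide_centre_def)
  show "inverse a * a = 1" if "a \<noteq> 0" using that by transfer simp
qed

end

definition cscale :: "'a::division_ring centre \<Rightarrow> 'a \<Rightarrow> 'a" where
  "cscale c x = Rep_centre c * x"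

interpretation cs: vector_space "cscale :: 'a::division_ring centre \<Rightarrow> 'a \<Rightarrow> 'a"
  by unfold_locales
    (simp_all add: cscale_def algebra_simps plus_centre.rep_eq times_centre.rep_eq one_centre.rep_eq)

lemma cscale_mult_right: "z * cscale c x = cscale c (z * x)"
proof -
  have "z * (Rep_centre c * x) = (z * Rep_centre c) * x" by (simp only: mult.assoc)
  also have "\<dots> = Rep_centre c * (z * x)"
    unfolding centD[OF Rep_centre[of c], of z, symmetric] by (rule mult.assoc)
  finally show ?thesis by (simp only: cscale_def)
qed

definition cent_finite :: "'a::division_ring itself \<Rightarrow> bool" where
  "cent_finite _ \<longleftrightarrow> (\<exists>S::'a set. finite S \<and> cs.span S = UNIV)"

text \<open>A power of the reduced norm: the determinant of left multiplication. It suffices here that this is a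
multiplicative map which sends a central $c$ to $c^n$ for a fixed $n > 0$.\<close>

lemma centre_norm:
  assumes "cent_finite TYPE('a::division_ring)"
  obtains \<delta> :: "'a::division_ring \<Rightarrow> 'a centre" and n :: nat
  where "n > 0" "\<And>x y. \<delta> (x * y) = \<delta> x * \<delta> y" "\<And>c. \<delta> (Rep_centre c) = c ^ n"
proof -
  obtain S :: "'a set" where S: "finite S" "cs.span S = UNIV"
    using assms by (auto simp: cent_finite_def)
  obtain B where B: "B \<subseteq> S" "cs.independent B" "S \<subseteq> cs.span B"
    using cs.maximal_independent_subset by blast
  have fB: "finite B" using B(1) S(1) by (rule finite_subset)
  have span: "v \<in> cs.span B" for v
    using B(3) S(2) cs.span_mono[of S "cs.span B"] by (auto simp: cs.span_span)
  obtain b where b: "bij_betw b {0..<card B} B"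
    using ex_bij_betw_nat_finite[OF fB] by blast
  define n where "n = card B"
  define R where "R = cs.representation B"
  have R_mult: "R (z * y) w = (\<Sum>k = 0..<n. R (z * b k) w * R y (b k))" for z y w
  proof -
    have "y = (\<Sum>v\<in>B. cscale (R y v) v)"
      unfolding R_def using cs.sum_representation_eq[OF B(2) span fB] by simp
    then have "y = (\<Sum>k = 0..<n. cscale (R y (b k)) (b k))"
      using sum.reindex_bij_betw[OF b, of "\<lambda>v. cscale (R y v) v"] by (simp add: n_def)
    then have "z * y = z * (\<Sum>k = 0..<n. cscale (R y (b k)) (b k))" by simp
    also have "\<dots> = (\<Sum>k = 0..<n. cscale (R y (b k)) (z * b k))"
      by (simp only: sum_distrib_left cscale_mult_right)
    finally have "z * y = (\<Sum>k = 0..<n. cscale (R y (b k)) (z * b k))" .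
    then have "R (z * y) w = R (\<Sum>k = 0..<n. cscale (R y (b k)) (z * b k)) w" by simp
    also have "\<dots> = (\<Sum>k = 0..<n. R (cscale (R y (b k)) (z * b k)) w)"
      unfolding R_def by (subst cs.representation_sum[OF B(2) span]) (rule refl)
    also have "\<dots> = (\<Sum>k = 0..<n. R (z * b k) w * R y (b k))"
      by (intro sum.cong) (simp_all add: R_def cs.representation_scale[OF B(2) span] mult.commute)
    finally show ?thesis by simp
  qed
  define M where "M z = mat n n (\<lambda>(i, j). R (z * b j) (b i))" for z
  have M: "M z \<in> carrier_mat n n" for z by (simp add: M_def)
  have "M (x * y) = M x * M y" for x y
  proof (rule eq_matI)
    fix i j assume "i < dim_row (M x * M y)" "j < dim_col (M x * M y)"
    then show "M (x * y) $$ (i, j) = (M x * M y) $$ (i, j)"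
      using R_mult[of x "y * b j" "b i"] by (simp add: M_def mult.assoc scalar_prod_def)
  qed (simp_all add: M_def)
  then have 1: "det (M (x * y)) = det (M x) * det (M y)" for x y
    using det_mult[OF M M] by simp
  have bb: "b i = b j \<longleftrightarrow> i = j" if "i < n" "j < n" for i j
    using b that by (auto simp: bij_betw_def inj_on_def n_def)
  have bB: "b i \<in> B" if "i < n" for i using b that by (auto simp: bij_betw_def n_def)
  have "M (Rep_centre c) = c \<cdot>\<^sub>m 1\<^sub>m n" for c
  proof (rule eq_matI)
    fix i j assume ij: "i < dim_row (c \<cdot>\<^sub>m 1\<^sub>m n)" "j < dim_col (c \<cdot>\<^sub>m 1\<^sub>m n)"
    then have ij: "i < n" "j < n" by auto
    have "R (Rep_centre c * b j) (b i) = c * R (b j) (b i)"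
      using cs.representation_scale[OF B(2) span, of c "b j"] by (simp add: R_def cscale_def)
    also have "R (b j) (b i) = (if i = j then 1 else 0)"
      unfolding R_def cs.representation_basis[OF B(2) bB[OF ij(2)]] using bb[OF ij] by simp
    finally show "M (Rep_centre c) $$ (i, j) = (c \<cdot>\<^sub>m 1\<^sub>m n) $$ (i, j)"
      using ij by (simp add: M_def)
  qed (simp_all add: M_def)
  then have 2: "det (M (Rep_centre c)) = c ^ n" for c by simp
  have "n > 0"
  proof (rule ccontr)
    assume "\<not> n > 0"
    then have "B = {}" using fB by (simp add: n_def)
    then have "(1::'a) \<in> {0}" using span[of 1] by simp
    then show False by simp
  qed
  then show ?thesis using that[of n "\<lambda>z. det (M z)"] 1 2 by blast
qed

text \<open>The norm is trivial on commutators because it takes values in a commutative group. If $w^k = c$ is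
central, then $c^n$ is the norm of $w^k$, which is $1$, and hence $w^{kn} = 1$.\<close>

lemma commutator_torsion:
  fixes u x :: "'a::division_ring"
  assumes fin: "cent_finite TYPE('a::division_ring)"
    and nz: "u \<noteq> 0" "x \<noteq> 0"
    and c: "(u * x * inverse u * inverse x) ^ k \<in> cent" and k: "k > 0"
  shows "\<exists>n>0. (u * x * inverse u * inverse x) ^ n = 1"
proof -
  obtain \<delta> :: "'a \<Rightarrow> 'a centre" and n :: nat
    where n: "n > 0" and \<delta>: "\<And>x y. \<delta> (x * y) = \<delta> x * \<delta> y" "\<And>c. \<delta> (Rep_centre c) = c ^ n"
    by (rule centre_norm[OF fin]) (rule that)
  have \<delta>1: "\<delta> 1 = 1" using \<delta>(2)[of 1] by (simp add: one_centre.rep_eq)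
  have \<delta>p: "\<delta> (y ^ j) = \<delta> y ^ j" for y j by (induction j) (simp_all add: \<delta>1 \<delta>(1))
  define w where "w = u * x * inverse u * inverse x"
  have "\<delta> w = \<delta> (u * inverse u) * \<delta> (x * inverse x)" by (simp only: w_def \<delta>(1) mult_ac)
  then have \<delta>w: "\<delta> w = 1" using nz by (simp add: \<delta>1)
  obtain h where h: "w ^ k = Rep_centre h" using c Abs_centre_inverse unfolding w_def by metis
  have "h ^ n = \<delta> (w ^ k)" by (simp only: h \<delta>(2))
  also have "\<dots> = 1" by (simp add: \<delta>p \<delta>w)
  finally have "Rep_centre (h ^ n) = 1" by (simp add: one_centre.rep_eq)
  moreover have "Rep_centre (h ^ j) = Rep_centre h ^ j" for j
    by (induction j) (simp_all add: one_centre.rep_eq times_centre.rep_eq)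
  ultimately have "w ^ (k * n) = 1" by (simp add: power_mult h)
  then show ?thesis unfolding w_def using k n by (intro exI[of _ "k * n"]) simp
qed

section \<open>Roots of unity and their eigenvectors\<close>

lemma one_plus_power:
  fixes z :: "'a::ring_1"
  shows "(1 + z) ^ n = (\<Sum>k\<le>n. of_nat (n choose k) * z ^ k)"
proof (induction n)
  case (Suc n)
  have "(\<Sum>k\<le>Suc n. of_nat (Suc n choose k) * z ^ k)
      = 1 + (\<Sum>k\<le>n. of_nat (n choose Suc k) * z ^ Suc k) + (\<Sum>k\<le>n. of_nat (n choose k) * z ^ Suc k)"
    by (subst sum.atMost_Suc_shift) (simp add: sum.distrib distrib_right add_ac)
  also have "1 + (\<Sum>k\<le>n. of_nat (n choose Suc k) * z ^ Suc k)
      = (\<Sum>k\<le>Suc n. of_nat (n choose k) * z ^ k)"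
    by (subst sum.atMost_Suc_shift) simp
  also have "\<dots> = (1 + z) ^ n" by (simp add: Suc binomial_eq_0)
  also have "(\<Sum>k\<le>n. of_nat (n choose k) * z ^ Suc k) = (1 + z) ^ n * z"
    unfolding Suc sum_distrib_right by (simp add: power_commutes mult.assoc)
  finally have "(\<Sum>k\<le>Suc n. of_nat (Suc n choose k) * z ^ k) = (1 + z) ^ n * (1 + z)"
    by (simp only: distrib_left mult_1_right)
  then show ?case by (simp only: power_Suc2)
qed simp

text \<open>$(y - 1)^p = y^p - 1$ in characteristic $p$.\<close>

lemma prime_char_root_of_unity:
  fixes y :: "'a::ring_1_no_zero_divisors"
  assumes p: "prime p" "of_nat p = (0::'a)" and y: "y ^ p = 1"
  shows "y = 1"
proof -
  have p0: "p > 0" using p(1) prime_gt_0_nat by blast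
  have zero: "of_nat (p choose k) = (0::'a)" if "k \<in> {0<..<p}" for k
  proof -
    have "p dvd p choose k" by (rule dvd_choose_prime) (use that p(1) in auto)
    then show ?thesis using p(2) by (auto elim!: dvdE)
  qed
  have "(1 + (y - 1)) ^ p = (\<Sum>k\<in>{0, p}. of_nat (p choose k) * (y - 1) ^ k)"
    unfolding one_plus_power using zero
    by (intro sum.mono_neutral_right) (auto simp: not_le)
  also have "\<dots> = 1 + (y - 1) ^ p" using p0 by simp
  finally show ?thesis using y p0 by simp
qed

lemma prime_characteristic:
  assumes "n > 0" "of_nat n = (0::'a::ring_1_no_zero_divisors)"
  obtains p where "prime p" "of_nat p = (0::'a)"
  using assms
proof (induction n arbitrary: thesis rule: less_induct)
  case (less n)
  have "n \<noteq> 1" using less.prems by auto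
  then obtain p where p: "prime p" "p dvd n" using prime_factor_nat by blast
  then obtain r where r: "n = p * r" by blast
  show ?case
  proof (cases "of_nat p = (0::'a)")
    case True then show ?thesis using less.prems(1) p by blast
  next
    case False
    then have "of_nat r = (0::'a)" using less.prems(3) r by simp
    moreover have "r > 0" "r < n" using less.prems(2) r p(1) prime_gt_1_nat[OF p(1)] by auto
    ultimately show ?thesis using less.IH less.prems(1) by blast
  qed
qed

lemma of_nat_eq_0_imp_dvd:
  assumes "prime p" "of_nat p = (0::'a::ring_1)" "of_nat n = (0::'a)" "(0::'a) \<noteq> 1"
  shows "p dvd n"
proof (rule ccontr)
  assume "\<not> p dvd n"
  then have "coprime p n" using assms(1) prime_imp_coprime by blast
  then have "coprime (int p) (int n)" by simp
  then obtain u v where "u * int p + v * int n = 1"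
    using bezout_int[of "int p" "int n"] by auto
  then have "of_int (u * int p + v * int n) = (1::'a)" by simp
  then show False using assms by simp
qed

lemma order_exists:
  fixes x :: "'a::monoid_mult"
  assumes "n > 0" "x ^ n = 1"
  obtains m where "m > 0" "x ^ m = 1" "\<And>k. k > 0 \<Longrightarrow> k < m \<Longrightarrow> x ^ k \<noteq> 1"
proof -
  define m where "m = (LEAST m. m > 0 \<and> x ^ m = 1)"
  have "m > 0 \<and> x ^ m = 1" unfolding m_def by (rule LeastI[of _ n]) (use assms in simp)
  moreover have "x ^ k \<noteq> 1" if "k > 0" "k < m" for k
    using that not_less_Least unfolding m_def by blast
  ultimately show ?thesis using that by blast
qed

lemma of_nat_order_ne_0:
  fixes x :: "'a::ring_1_no_zero_divisors"
  assumes m: "m > 0" "x ^ m = 1" "\<And>k. k > 0 \<Longrightarrow> k < m \<Longrightarrow> x ^ k \<noteq> 1"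
  shows "of_nat m \<noteq> (0::'a)"
proof
  assume 0: "of_nat m = (0::'a)"
  obtain p where p: "prime p" "of_nat p = (0::'a)" using prime_characteristic[OF m(1) 0] by blast
  then obtain t where t: "m = t * p" using of_nat_eq_0_imp_dvd[OF p 0] by (metis dvd_div_mult_self zero_neq_one)
  have "x ^ t = 1" using prime_char_root_of_unity[OF p, of "x ^ t"] m(2) t by (simp add: power_mult)
  moreover have "t > 0" "t < m" using t m(1) prime_gt_1_nat[OF p(1)] by auto
  ultimately show False using m(3) by blast
qed

lemma geometric_factor:
  fixes x :: "'a::ring_1"
  shows "(1 - x) * (\<Sum>i<n. x ^ i) = 1 - x ^ n" "(\<Sum>i<n. x ^ i) * (1 - x) = 1 - x ^ n"
proof (induction n)
  case (Suc n)
  have "(1 - x) * (\<Sum>i<Suc n. x ^ i) = 1 - x ^ n + (1 - x) * x ^ n"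
    by (simp only: sum.lessThan_Suc distrib_left Suc)
  then show "(1 - x) * (\<Sum>i<Suc n. x ^ i) = 1 - x ^ Suc n" by (simp add: left_diff_distrib)
  have "(\<Sum>i<Suc n. x ^ i) * (1 - x) = 1 - x ^ n + x ^ n * (1 - x)"
    by (simp only: sum.lessThan_Suc distrib_right Suc)
  then show "(\<Sum>i<Suc n. x ^ i) * (1 - x) = 1 - x ^ Suc n"
    by (simp add: right_diff_distrib power_commutes)
qed simp_all

text \<open>Conjugation by $e$ is an operator of order $m$, where $m$ is the order of $e$. The sums $E_j(d)$ in
the proof are its (unnormalized) projections onto the eigenspaces with eigenvalue $e^j$; they exist
since the left scalars $e^j$ are $m$-th roots of unity and $m$ is invertible. As they add up to $m d$,
conjugation would be trivial if only $E_0$ were nonzero.\<close>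

lemma eigenvector:
  fixes e :: "'a::division_ring"
  assumes tors: "n > 0" "e ^ n = 1" and nc: "e \<notin> cent"
  obtains a j where "a \<noteq> 0" "e * a = e ^ j * a * e" "e * a \<noteq> a * e"
proof -
  obtain m where m: "m > 0" "e ^ m = 1" "\<And>k. k > 0 \<Longrightarrow> k < m \<Longrightarrow> e ^ k \<noteq> 1"
    using order_exists[OF tors] by metis
  define h where "h = inverse e"
  have e0: "e \<noteq> 0" using tors by (auto simp: power_0_left)
  have eh: "e * h = 1" "h * e = 1" using e0 by (simp_all add: h_def)
  have hm: "h ^ m = 1" using m(2) e0 by (simp add: h_def power_inverse)
  define f where "f j d k = h ^ (j * k) * (e ^ k * d * h ^ k)" for j d k
  define E where "E j d = (\<Sum>k<m. f j d k)" for j d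
  have ehj: "e ^ j * h ^ j = 1" for j
    using e0 by (simp add: h_def power_inverse)
  have comm: "e * h ^ j = h ^ j * e" for j
    using power_commuting_commutes[of h e j] eh by simp
  have eig: "e * E j d * h = e ^ j * E j d" for j d
  proof -
    have "e * f j d k * h = e ^ j * f j d (Suc k)" for k
    proof -
      have "e ^ j * f j d (Suc k) = (e ^ j * h ^ j) * h ^ (j * k) * (e * e ^ k * d * (h ^ k * h))"
        by (simp add: f_def power_add mult.assoc power_commutes)
      also have "\<dots> = (h ^ (j * k) * e) * (e ^ k * d * h ^ k) * h"
        by (simp add: ehj mult.assoc)
      finally show ?thesis by (simp add: f_def comm[symmetric] mult.assoc)
    qed
    then have "e * E j d * h = e ^ j * (\<Sum>k<m. f j d (Suc k))"
      by (simp add: E_def sum_distrib_left sum_distrib_right)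
    also have "(\<Sum>k<m. f j d (Suc k)) = (\<Sum>k<m. f j d k) + f j d m - f j d 0"
      using sum.lessThan_Suc_shift[of "f j d" m] by (simp add: algebra_simps)
    also have "f j d m = f j d 0" by (simp add: f_def m hm power_mult mult.commute[of j] )
    finally show ?thesis by (simp add: E_def)
  qed
  have eig': "e * E j d = e ^ j * E j d * e" for j d
    using arg_cong[OF eig[of j d], of "\<lambda>x. x * e"] by (simp add: mult.assoc eh)
  have mE: "of_nat m * d = (\<Sum>j<m. E j d)" for d
  proof -
    have "(\<Sum>j<m. E j d) = (\<Sum>k<m. (\<Sum>j<m. (h ^ k) ^ j) * (e ^ k * d * h ^ k))"
      unfolding E_def f_def
      by (subst sum.swap) (simp add: sum_distrib_right power_mult mult.commute[of _ "_ :: nat"] flip: power_mult)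
    also have "\<dots> = (\<Sum>k\<in>{0}. (\<Sum>j<m. (h ^ k) ^ j) * (e ^ k * d * h ^ k))"
    proof (rule sum.mono_neutral_right)
      show "\<forall>k\<in>{..<m} - {0}. (\<Sum>j<m. (h ^ k) ^ j) * (e ^ k * d * h ^ k) = 0"
      proof
        fix k assume "k \<in> {..<m} - {0}"
        then have "e ^ k \<noteq> 1" using m(3) by auto
        then have "h ^ k \<noteq> 1" using ehj[of k] by auto
        moreover have "(1 - h ^ k) * (\<Sum>j<m. (h ^ k) ^ j) = 0"
          unfolding geometric_factor using hm by (metis power_mult mult.commute power_one diff_self)
        ultimately have "(\<Sum>j<m. (h ^ k) ^ j) = 0" by simp
        then show "(\<Sum>j<m. (h ^ k) ^ j) * (e ^ k * d * h ^ k) = 0" by simp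
      qed
    qed (use m(1) in auto)
    finally show ?thesis by simp
  qed
  obtain d where d: "e * d \<noteq> d * e" using nc by (auto simp: cent_def)
  have "\<exists>j. 0 < j \<and> j < m \<and> E j d \<noteq> 0"
  proof (rule ccontr)
    assume "\<not> ?thesis"
    then have "(\<Sum>j\<in>{..<m} - {0}. E j d) = 0" by (intro sum.neutral) auto
    then have "of_nat m * d = E 0 d"
      unfolding mE using m(1) by (subst sum.remove[of _ 0]) auto
    then have "e * (of_nat m * d) = (of_nat m * d) * e" using eig'[of 0 d] by simp
    then have "of_nat m * (e * d) = of_nat m * (d * e)"
      by (metis mult.assoc mult_of_nat_commute)
    then show False using d of_nat_order_ne_0[OF m] by simp
  qed
  then obtain j where j: "0 < j" "j < m" "E j d \<noteq> 0" by blast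
  have "e * E j d \<noteq> E j d * e"
  proof
    assume "e * E j d = E j d * e"
    then have "(e ^ j - 1) * (E j d * e) = 0" using eig'[of j d] by (simp add: algebra_simps)
    then show False using j m(3)[OF j(1,2)] e0 by simp
  qed
  then show ?thesis using that[OF j(3) eig'] by blast
qed

lemma power_mult_commuting:
  fixes x y :: "'a::monoid_mult"
  assumes "x * y = y * x"
  shows "(x * y) ^ n = x ^ n * y ^ n"
proof (induction n)
  case (Suc n)
  have "(x * y) ^ Suc n = x * (y * x ^ n) * y ^ n" by (simp add: Suc mult.assoc)
  also have "y * x ^ n = x ^ n * y" using power_commuting_commutes[of x y n] assms by simp
  finally show ?case by (simp add: mult.assoc)
qed simp

section \<open>Roots of unity congruent to one\<close>

text \<open>With $s = 1 - (-v)^k$ the geometric series gives $(1 + v)^{-1} = g s^{-1}$ with $g \in 1 + I$. The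
denominator $s \in 1 + I$ commutes with $w$, and $w s \in 1 + I$. If a power $y$ of $w$ has prime order
$q$, then $0 = 1 + y + \dots + y^{q-1}$. Multiplied by the $q$-th power of a denominator, every summand
lies in $1 + I$, so $q \in I$.\<close>

lemma unipotent_torsion:
  fixes A I :: "'a::division_ring set"
  assumes A: "1 \<in> A" "\<And>x y. x \<in> A \<Longrightarrow> y \<in> A \<Longrightarrow> x + y \<in> A"
    and I: "I \<subseteq> A" "0 \<in> I" "\<And>x y. x \<in> I \<Longrightarrow> y \<in> I \<Longrightarrow> x + y \<in> I" "\<And>x. x \<in> I \<Longrightarrow> - x \<in> I"
      "\<And>x y. x \<in> A \<Longrightarrow> y \<in> I \<Longrightarrow> x * y \<in> I" "\<And>x y. x \<in> I \<Longrightarrow> y \<in> A \<Longrightarrow> x * y \<in> I"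
    and c: "c \<in> A" and v: "v \<in> I" and k: "k > 0" "v ^ k * c = c * v ^ k" and nz: "1 + v \<noteq> 0"
    and w: "w = (1 + c * v) * inverse (1 + v)" "w \<noteq> 1" "w ^ n = 1" "n > 0"
  shows "\<exists>q. prime q \<and> of_nat q \<noteq> (0::'a) \<and> of_nat q \<in> I"
proof (cases "(1::'a) \<in> I")
  case True
  have all: "of_nat q \<in> I" for q by (induction q) (use I(2,3) True in auto)
  have "of_nat 2 \<noteq> (0::'a) \<or> of_nat 3 \<noteq> (0::'a)"
  proof (rule ccontr)
    assume "\<not> ?thesis"
    then have "of_nat 3 - of_nat 2 = (0::'a)" by simp
    then show False by simp
  qed
  moreover have "prime (2::nat)" "prime (3::nat)" by simp_all
  ultimately show ?thesis using all by blast
next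
  case False
  define U where "U = {x. x - 1 \<in> I}"
  have UA: "x \<in> A" if "x \<in> U" for x
    using A(2)[OF A(1), of "x - 1"] that I(1) by (auto simp: U_def)
  have U1: "1 \<in> U" using I(2) by (simp add: U_def)
  have U_add: "1 + x \<in> U" if "x \<in> I" for x using that by (simp add: U_def)
  have U_mult: "x * y \<in> U" if "x \<in> U" "y \<in> U" for x y
  proof -
    have "x * y - 1 = (x - 1) * y + (y - 1)" by (simp add: algebra_simps)
    moreover have "(x - 1) * y + (y - 1) \<in> I"
      using that UA[OF that(2)] by (intro I(3) I(6)) (simp_all add: U_def)
    ultimately show ?thesis unfolding U_def by (simp only: mem_Collect_eq)
  qed
  have U_pow: "x ^ j \<in> U" if "x \<in> U" for x j
    by (induction j) (use U1 U_mult that in auto)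
  have I_pow: "x ^ Suc j \<in> I" if "x \<in> I" for x j
    by (induction j) (use I(1,5) that in auto)
  define g where "g = (\<Sum>i<k. (- v) ^ i)"
  define s where "s = 1 - (- v) ^ k"
  have sg: "(1 + v) * g = s" using geometric_factor(1)[of "- v" k] by (simp add: g_def s_def)
  have g: "g \<in> U"
  proof -
    obtain k' where k': "k = Suc k'" using k(1) gr0_implies_Suc by blast
    have "(\<Sum>i<j. (- v) ^ Suc i) \<in> I" for j
      by (induction j) (use I(2,3) I_pow[OF I(4)[OF v]] in \<open>auto simp del: power_Suc\<close>)
    then show ?thesis unfolding g_def k' sum.lessThan_Suc_shift using U_add by simp
  qed
  have s: "s \<in> U"
  proof -
    obtain k' where k': "k = Suc k'" using k(1) gr0_implies_Suc by blast
    have "- ((- v) ^ k) \<in> I" unfolding k' by (rule I(4)[OF I_pow[OF I(4)[OF v]]])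
    then show ?thesis using U_add unfolding s_def by (metis diff_conv_add_uminus)
  qed
  have s0: "s \<noteq> 0" using s False I(4)[of "-1"] by (auto simp: U_def)
  have ws: "w * s = (1 + c * v) * g"
    unfolding sg[symmetric] w(1) using nz by (simp add: mult.assoc) (simp flip: mult.assoc)
  have wsU: "w * s \<in> U" unfolding ws using U_mult[OF U_add[OF I(5)[OF c v]] g] .
  have mvk: "(- v) ^ k = v ^ k \<or> (- v) ^ k = - (v ^ k)" by (metis power_minus_even power_minus_odd)
  have sc: "s * c = c * s" unfolding s_def using mvk k(2) by (auto simp: algebra_simps)
  have sv: "s * v = v * s" unfolding s_def using mvk by (auto simp: algebra_simps power_commutes)
  have "s * inverse (1 + v) = inverse (1 + v) * s"
  proof -
    have "s * (1 + v) = (1 + v) * s" using sv by (simp add: algebra_simps)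
    then show ?thesis by (metis mult_commute_imp_mult_inverse_commute)
  qed
  moreover have "s * (1 + c * v) = (1 + c * v) * s"
  proof -
    have "s * (c * v) = (c * s) * v" using sc by (simp flip: mult.assoc)
    also have "\<dots> = (c * v) * s" using sv by (simp add: mult.assoc)
    finally show ?thesis by (simp add: distrib_left distrib_right)
  qed
  ultimately have comm: "w * s = s * w" unfolding w(1) by (metis mult.assoc)
  obtain m where m: "m > 0" "w ^ m = 1" "\<And>k. k > 0 \<Longrightarrow> k < m \<Longrightarrow> w ^ k \<noteq> 1"
    using order_exists[OF w(4,3)] by metis
  have "m \<noteq> 1" using m(2) w(2) by auto
  then obtain q where q: "prime q" "q dvd m" using prime_factor_nat by blast
  then obtain t where t: "m = t * q" by (metis dvd_div_mult_self)
  have t': "t > 0" "t < m" using t m(1) prime_gt_1_nat[OF q(1)] by auto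
  define y where "y = w ^ t"
  define S where "S = s ^ t"
  have y: "y \<noteq> 1" "y ^ q = 1" using m(2) m(3)[OF t'] t by (auto simp: y_def power_mult)
  have yS: "y * S = S * y"
    unfolding y_def S_def using comm by (metis power_commuting_commutes)
  have ySU: "y * S \<in> U" unfolding y_def S_def power_mult_commuting[OF comm, symmetric]
    using U_pow[OF wsU] .
  have SU: "S \<in> U" unfolding S_def using U_pow[OF s] .
  have "(1 - y) * (\<Sum>i<q. y ^ i) = 0" unfolding geometric_factor using y by simp
  then have "(\<Sum>i<q. y ^ i) = 0" using y by simp
  then have "0 = (\<Sum>i<q. y ^ i) * S ^ q" by simp
  also have "\<dots> = (\<Sum>i<q. (y * S) ^ i * S ^ (q - i))"
    unfolding sum_distrib_right power_mult_commuting[OF yS]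
    by (intro sum.cong) (simp_all add: mult.assoc flip: power_add)
  finally have "0 = (\<Sum>i<q. (y * S) ^ i * S ^ (q - i) - 1) + of_nat q"
    by (simp add: sum_subtractf)
  moreover have "(\<Sum>i<j. (y * S) ^ i * S ^ (q - i) - 1) \<in> I" for j
  proof (induction j)
    case (Suc j)
    have "(y * S) ^ j * S ^ (q - j) \<in> U" by (intro U_mult U_pow ySU SU)
    then show ?case using I(3)[OF Suc] by (simp add: U_def)
  qed (simp add: I(2))
  ultimately have "- of_nat q \<in> I" by (metis minus_unique add.commute)
  then have "of_nat q \<in> I" using I(4) by fastforce
  moreover have "of_nat q \<noteq> (0::'a)"
    using prime_char_root_of_unity[OF q(1) _ y(2)] y(1) by blast
  ultimately show ?thesis using q(1) by blast
qed

section \<open>Integer spans\<close>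

interpretation zs: Modules.module "\<lambda>(n::int) (x::'a::ring_1). of_int n * x"
  by unfold_locales (simp_all add: algebra_simps)

lemma zspan_mult:
  assumes "x \<in> zs.span S" "y \<in> zs.span T" and ST: "\<And>s t. s \<in> S \<Longrightarrow> t \<in> T \<Longrightarrow> s * t \<in> zs.span V"
  shows "x * y \<in> zs.span V"
  using assms(1)
proof (induction rule: zs.span_induct_alt)
  case (step n s x)
  have "s * y \<in> zs.span V"
    using assms(2)
  proof (induction rule: zs.span_induct_alt)
    case (step n t y)
    have "s * (of_int n * t + y) = of_int n * (s * t) + s * y"
      by (simp add: distrib_left) (metis mult.assoc mult_of_int_commute)
    then show ?case using zs.span_add[OF zs.span_scale[OF ST] step.IH] \<open>s \<in> S\<close> step by simp
  qed (simp add: zs.span_zero)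
  then show ?case using zs.span_add[OF zs.span_scale step.IH] by (simp add: distrib_right mult.assoc)
qed (simp add: zs.span_zero)

text \<open>Nakayama's lemma for the integers localized at $2$: a finitely generated torsion-free module that is
equal to twice itself is zero. Odd multiples $e g$ stand in for the localization, and one generator is
eliminated in each induction step.\<close>

lemma two_divisible_span_trivial:
  fixes G :: "'a::division_ring set"
  assumes char0: "\<And>n. n > 0 \<Longrightarrow> of_nat n \<noteq> (0::'a)" and "finite G"
    and "\<And>g. g \<in> G \<Longrightarrow> \<exists>e h. odd e \<and> h \<in> zs.span G \<and> of_int e * g = 2 * h"
  shows "G \<subseteq> {0}"
  using assms(2,3)
proof (induction G)
  case (insert g0 G)
  have split: "\<exists>n k. h = of_int n * g0 + k \<and> k \<in> zs.span G" if "h \<in> zs.span (insert g0 G)" for h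
  proof -
    from that obtain n where "h - of_int n * g0 \<in> zs.span G" by (auto simp: zs.span_insert)
    then show ?thesis by (intro exI[of _ n] exI[of _ "h - of_int n * g0"]) simp
  qed
  obtain e0 n0 h0 where e0: "odd e0" "of_int e0 * g0 = 2 * (of_int n0 * g0 + h0)" "h0 \<in> zs.span G"
    using insert.prems[of g0] split by blast
  define d where "d = e0 - 2 * n0"
  have d: "odd d" "of_int d * g0 = 2 * h0"
    using e0(1,2) by (simp_all add: d_def distrib_left left_diff_distrib mult.assoc)
  have "G \<subseteq> {0}"
  proof (rule insert.IH)
    fix g assume "g \<in> G"
    then obtain e n h where e: "odd e" "of_int e * g = 2 * (of_int n * g0 + h)" "h \<in> zs.span G"
      using insert.prems[of g] split by blast
    have "of_int (d * e) * g = of_int d * (of_int 2 * (of_int n * g0 + h))"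
      by (simp add: mult.assoc e(2))
    also have "\<dots> = of_int (d * 2 * n) * g0 + of_int (d * 2) * h"
      by (simp only: distrib_left mult.assoc of_int_mult)
    also have "d * 2 * n = 2 * n * d" by simp
    also have "of_int (2 * n * d) * g0 = of_int (2 * n) * (of_int 2 * h0)"
      using d(2) by (simp add: mult.assoc)
    also have "\<dots> = of_int (2 * n * 2) * h0" by (simp only: of_int_mult mult.assoc)
    also have "2 * n * 2 = 2 * (2 * n)" by simp
    also have "d * 2 = 2 * d" by simp
    also have "of_int (2 * (2 * n)) * h0 + of_int (2 * d) * h = 2 * (of_int (2 * n) * h0 + of_int d * h)"
      by (simp only: distrib_left mult.assoc of_int_mult of_int_numeral)
    finally have "of_int (d * e) * g = 2 * (of_int (2 * n) * h0 + of_int d * h)" .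
    moreover have "of_int (2 * n) * h0 + of_int d * h \<in> zs.span G"
      by (intro zs.span_add zs.span_scale e0(3) e(3))
    ultimately show "\<exists>e h. odd e \<and> h \<in> zs.span G \<and> of_int e * g = 2 * h"
      using d(1) e(1) by (intro exI[of _ "d * e"] exI[of _ "of_int (2 * n) * h0 + of_int d * h"]) simp
  qed
  then have "zs.span G \<subseteq> {0}"
    by (rule zs.span_minimal) (simp add: zs.subspace_single_0)
  then have "of_int d * g0 = 0" using d(2) e0(3) by auto
  moreover have "of_int d \<noteq> (0::'a)"
  proof
    assume "of_int d = (0::'a)"
    then have "of_int \<bar>d\<bar> = (0::'a)" by (simp add: abs_if)
    then have "of_nat (nat \<bar>d\<bar>) = (0::'a)" by (metis of_int_of_nat_eq abs_ge_zero int_nat_eq nat_0_le)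
    then show False using char0[of "nat \<bar>d\<bar>"] d(1) by (cases "d = 0") auto
  qed
  ultimately show ?case using \<open>G \<subseteq> {0}\<close> by simp
qed simp

section \<open>A case of Wedderburn's theorem\<close>

lemma card_hom_fibres:
  fixes f :: "'a::division_ring \<Rightarrow> 'b::division_ring"
  assumes fin: "finite G" and "0 \<notin> G" and mult: "\<And>x y. x \<in> G \<Longrightarrow> y \<in> G \<Longrightarrow> x * y \<in> G"
    and inv: "\<And>x. x \<in> G \<Longrightarrow> inverse x \<in> G"
    and hom: "\<And>x y. x \<in> G \<Longrightarrow> y \<in> G \<Longrightarrow> f (x * y) = f x * f y" and nz: "\<And>x. x \<in> G \<Longrightarrow> f x \<noteq> 0"
  shows "card G = card (f ` G) * card {x \<in> G. f x = 1}"
proof -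
  have fibre: "card {x \<in> G. f x = c} = card {x \<in> G. f x = 1}" if "c \<in> f ` G" for c
  proof -
    obtain x0 where x0: "x0 \<in> G" "f x0 = c" using \<open>c \<in> f ` G\<close> by blast
    have x00: "x0 \<noteq> 0" using x0 assms(2) by blast
    have "bij_betw (\<lambda>x. x0 * x) {x \<in> G. f x = 1} {x \<in> G. f x = c}"
    proof (rule bij_betwI[where g = "\<lambda>x. inverse x0 * x"])
      show "(\<lambda>x. x0 * x) \<in> {x \<in> G. f x = 1} \<rightarrow> {x \<in> G. f x = c}"
        using x0 mult hom by auto
      have "f (inverse x0 * x) = 1" if "x \<in> G" "f x = c" for x
      proof -
        have "f x0 * f (inverse x0 * x) = f x"
          using hom[OF x0(1) mult[OF inv[OF x0(1)] that(1)]] x00 by (simp flip: mult.assoc)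
        then have "f x0 * (f (inverse x0 * x) - 1) = 0" using that(2) x0(2) by (simp add: algebra_simps)
        then show ?thesis using nz[OF x0(1)] by simp
      qed
      then show "(\<lambda>x. inverse x0 * x) \<in> {x \<in> G. f x = c} \<rightarrow> {x \<in> G. f x = 1}"
        using x0 mult inv by auto
    qed (use x00 in \<open>auto simp flip: mult.assoc\<close>)
    then show ?thesis using bij_betw_same_card by fastforce
  qed
  have "card G = (\<Sum>x\<in>G. 1)" by simp
  also have "\<dots> = (\<Sum>c\<in>f ` G. \<Sum>x\<in>{x \<in> G. f x = c}. 1)" by (rule sum.image_gen[OF fin])
  also have "\<dots> = (\<Sum>c\<in>f ` G. card {x \<in> G. f x = 1})"
    by (rule sum.cong[OF refl]) (simp add: fibre)
  finally show ?thesis by simp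
qed

text \<open>Let $\tau$ be conjugation by $a$, let $k$ be the order of its action on $e$, and $b = a^k$. It acts on the
finite field $L$ that arises as the double centralizer of $e$ and $b$. By Hilbert's Theorem 90 and a
count, the norm $N(y) = y\, \tau(y) \cdots \tau^{k-1}(y)$ maps $L^*$ onto the group of elements fixed by
$\tau$, so $N(y) = b^{-1}$ for some $y$. Then $r = y a$ satisfies $r^k = N(y) b = 1$ and $r \neq 1$, hence
$1 + r + \dots + r^{k-1} = 0$. This contradicts the independence of the automorphisms
$1, \tau, \dots, \tau^{k-1}$ of $L$.\<close>

lemma finite_twisted_commute:
  fixes e a :: "'a::division_ring"
  assumes fin: "finite A" and A: "1 \<in> A" "e \<in> A" "a \<in> A"
    and add: "\<And>x y. x \<in> A \<Longrightarrow> y \<in> A \<Longrightarrow> x + y \<in> A"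
    and mult: "\<And>x y. x \<in> A \<Longrightarrow> y \<in> A \<Longrightarrow> x * y \<in> A"
    and a0: "a \<noteq> 0" and twist: "a * e = e ^ i * a"
  shows "a * e = e * a"
proof (rule ccontr)
  assume nc: "a * e \<noteq> e * a"
  have pow: "x ^ n \<in> A" if "x \<in> A" for x n by (induction n) (use A mult that in auto)
  have tors: "\<exists>n>0. x ^ n = 1" if x: "x \<in> A" "x \<noteq> 0" for x
  proof -
    have "range (\<lambda>n. x ^ n) \<subseteq> A" using pow[OF x(1)] by blast
    then have "\<not> inj (\<lambda>n::nat. x ^ n)" using fin finite_imageD finite_subset infinite_UNIV_nat by metis
    then obtain p q :: nat where "p < q" "x ^ p = x ^ q" by (metis (mono_tags) injI linorder_neqE_nat)
    moreover from this(1) have "x ^ q = x ^ p * x ^ (q - p)" by (simp flip: power_add)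
    ultimately have "x ^ p * (x ^ (q - p) - 1) = 0" by (simp add: algebra_simps)
    then show ?thesis using x(2) \<open>p < q\<close> by (intro exI[of _ "q - p"]) simp
  qed
  have inv: "inverse x \<in> A" if x: "x \<in> A" for x
  proof (cases "x = 0")
    case False
    then obtain n where "n > 0" "x ^ n = 1" using tors x by blast
    then have "x * x ^ (n - 1) = 1" by (simp flip: power_Suc)
    then have "inverse x = x ^ (n - 1)" by (metis inverse_unique)
    then show ?thesis using pow x by simp
  qed (use x in simp)
  have m1: "- 1 \<in> A"
  proof -
    have "\<not> inj (\<lambda>n::nat. of_nat n :: 'a)"
    proof
      assume "inj (\<lambda>n::nat. of_nat n :: 'a)"
      moreover have "of_nat (Suc n) \<in> A" for n by (induction n) (use A add in auto)
      then have "(\<lambda>n. of_nat (Suc n)) ` UNIV \<subseteq> A" by blast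
      then have "finite ((\<lambda>n. of_nat (Suc n) :: 'a) ` UNIV)" using fin finite_subset by blast
      ultimately show False
        using finite_imageD[of "\<lambda>n. of_nat (Suc n) :: 'a" UNIV] by (auto simp: inj_on_def)
    qed
    then obtain p q :: nat where pq: "p < q" "(of_nat p :: 'a) = of_nat q"
      by (metis (mono_tags) injI linorder_neqE_nat)
    have "(of_nat (q - p) :: 'a) = 0" using pq by (simp add: of_nat_diff)
    then have "- 1 = (of_nat (q - p) - 1 :: 'a)" by simp
    also have "\<dots> = of_nat (q - p - 1)" using pq(1) by (simp add: of_nat_diff)
    moreover have "of_nat (Suc n) \<in> A" for n by (induction n) (use A add in auto)
    moreover have "q - p - 1 \<noteq> 0"
    proof
      assume "q - p - 1 = 0"
      then have "q - p = 1" using pq(1) by simp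
      then show False using \<open>(of_nat (q - p) :: 'a) = 0\<close> by simp
    qed
    ultimately show ?thesis by (metis not0_implies_Suc)
  qed
  have minus: "x - y \<in> A" if "x \<in> A" "y \<in> A" for x y
    using add[OF that(1) mult[OF m1 that(2)]] by simp
  define k where "k = (LEAST k. k > 0 \<and> a ^ k * e = e * a ^ k)"
  have k: "k > 0" "a ^ k * e = e * a ^ k"
  proof -
    obtain n where "n > 0" "a ^ n = 1" using tors A(3) a0 by blast
    then have ex: "\<exists>k>0. a ^ k * e = e * a ^ k" by (intro exI[of _ n]) simp
    show "k > 0" "a ^ k * e = e * a ^ k"
      using LeastI_ex[OF ex] unfolding k_def by blast+
  qed
  have kmin: "a ^ j * e \<noteq> e * a ^ j" if "0 < j" "j < k" for j
    using that not_less_Least unfolding k_def by blast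
  define b where "b = a ^ k"
  have b0: "b \<noteq> 0" and bA: "b \<in> A" and be: "b * e = e * b" and ba: "b * a = a * b"
    using a0 A(3) pow k by (auto simp: b_def power_commutes)
  define C where "C = {c \<in> A. c * e = e * c \<and> c * b = b * c}"
  define L where "L = {y \<in> A. \<forall>c\<in>C. c * y = y * c}"
  have eC: "e \<in> C" "b \<in> C" using A be bA by (auto simp: C_def)
  have LA: "x \<in> A" if "x \<in> L" for x using that by (simp add: L_def)
  have LC: "x \<in> C" if "x \<in> L" for x using that eC by (auto simp: C_def L_def)
  have Lc: "x * y = y * x" if "x \<in> L" "y \<in> L" for x y
    using LC[OF that(1)] that(2) by (simp add: L_def)
  have L1: "1 \<in> L" "e \<in> L" "b \<in> L" using A bA by (auto simp: L_def C_def)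
  have L_add: "x + y \<in> L" if "x \<in> L" "y \<in> L" for x y
    using that add by (simp add: L_def algebra_simps)
  have L_mult: "x * y \<in> L" if "x \<in> L" "y \<in> L" for x y
  proof -
    have "c * (x * y) = x * y * c" if c: "c \<in> C" for c
    proof -
      have "c * x = x * c" "c * y = y * c" using c \<open>x \<in> L\<close> \<open>y \<in> L\<close> by (simp_all add: L_def)
      then have "(c * x) * y = x * (y * c)" by (simp add: mult.assoc)
      then show ?thesis by (simp only: mult.assoc)
    qed
    then show ?thesis using that mult by (simp add: L_def)
  qed
  have L_inv: "inverse x \<in> L" if "x \<in> L" for x
    using that inv by (simp add: L_def) (metis mult_commute_imp_mult_inverse_commute)
  define t where "t j y = a ^ j * y * inverse (a ^ j)" for j y
  have t_a: "a ^ j * y = t j y * a ^ j" for j y by (simp add: t_def mult.assoc a0)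
  have t1_L: "t 1 y \<in> L" if y: "y \<in> L" for y
  proof -
    have "c * t 1 y = t 1 y * c" if c: "c \<in> C" for c
    proof -
      define c' where "c' = inverse a * c * a"
      have c: "c \<in> A" "c * e = e * c" "c * b = b * c" using that by (auto simp: C_def)
      have ac': "a * c' = c * a" unfolding c'_def using a0 by (simp flip: mult.assoc)
      have "c * e ^ i = e ^ i * c" using power_commuting_commutes[of e c i] c(2) by simp
      then have "a * (c' * e) = a * (e * c')"
        by (metis ac' twist mult.assoc)
      then have 1: "c' * e = e * c'" using a0 by simp
      have "a * (c' * b) = a * (b * c')" by (metis ac' ba c(3) mult.assoc)
      then have "c' * b = b * c'" using a0 by simp
      then have "c' \<in> C" using 1 c(1) A(3) inv mult by (simp add: C_def c'_def)
      then have cy: "c' * y = y * c'" using y by (simp add: L_def)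
      have "c * t 1 y = (c * a) * y * inverse a" by (simp add: t_def mult.assoc)
      also have "\<dots> = a * (c' * y) * inverse a" by (simp only: ac'[symmetric] mult.assoc)
      also have "\<dots> = a * y * (c' * inverse a)" by (simp only: cy mult.assoc)
      also have "c' * inverse a = inverse a * c" by (simp add: c'_def mult.assoc a0)
      finally show ?thesis by (simp add: t_def mult.assoc)
    qed
    moreover have "t 1 y \<in> A" unfolding t_def using mult[OF mult] pow inv LA[OF y] A(3) by blast
    ultimately show ?thesis unfolding L_def by blast
  qed
  have t_Suc: "t (Suc j) y = t 1 (t j y)" for j y
    using a0 by (simp add: t_def mult.assoc nonzero_inverse_mult_distrib power_commutes)
  have t_L: "t j y \<in> L" if "y \<in> L" for j y
    by (induction j) (use that t1_L in \<open>auto simp: t_Suc simp del: One_nat_def, simp add: t_def\<close>)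
  have t_mult: "t j (x * y) = t j x * t j y" for j x y
  proof -
    have "inverse (a ^ j) * (a ^ j * u) = u" for u using a0 by (simp flip: mult.assoc)
    then show ?thesis by (simp only: t_def mult.assoc)
  qed
  have t_one: "t j 1 = 1" for j using a0 by (simp add: t_def)
  have t_ne: "t p e \<noteq> t q e" if "p < q" "q < k" for p q
  proof
    assume eq: "t p e = t q e"
    have aq: "a ^ q = a ^ p * a ^ (q - p)" using that by (simp flip: power_add)
    have "a ^ p * (a ^ (q - p) * e) = t q e * a ^ q"
      using t_a[of q e] unfolding aq by (simp only: mult.assoc)
    also have "\<dots> = t p e * a ^ p * a ^ (q - p)" by (simp only: eq[symmetric] aq mult.assoc)
    also have "\<dots> = a ^ p * (e * a ^ (q - p))" by (simp only: t_a[symmetric] mult.assoc)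
    finally show False using kmin[of "q - p"] that a0 by simp
  qed
  \<comment> \<open>Dedekind's independence of automorphisms; the shortening step uses only that the \<open>t j e\<close> are distinct.\<close>
  have indep: "\<forall>j<n. d j = 0" if "n \<le> k" "\<forall>x\<in>L. (\<Sum>j<n. t j x * d j) = 0" for n d
    using that
  proof (induction n arbitrary: d)
    case (Suc n)
    have "\<forall>x\<in>L. (\<Sum>j<n. t j x * ((t j e - t n e) * d j)) = 0"
    proof
      fix x assume x: "x \<in> L"
      have "t j x * ((t j e - t n e) * d j) = t j (e * x) * d j - t n e * (t j x * d j)" for j
      proof -
        have "t j x * t j e = t j e * t j x" "t j x * t n e = t n e * t j x"
          using Lc t_L x L1 by blast+
        then show ?thesis by (simp add: t_mult algebra_simps flip: mult.assoc)
      qed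
      then have "(\<Sum>j<n. t j x * ((t j e - t n e) * d j))
          = (\<Sum>j<n. t j (e * x) * d j) - t n e * (\<Sum>j<n. t j x * d j)"
        by (simp add: sum_subtractf sum_distrib_left)
      also have "\<dots> = (\<Sum>j<Suc n. t j (e * x) * d j) - t n e * (\<Sum>j<Suc n. t j x * d j)"
        by (simp add: t_mult algebra_simps)
      also have "\<dots> = 0" using Suc.prems(2) x L_mult[OF L1(2) x] by simp
      finally show "(\<Sum>j<n. t j x * ((t j e - t n e) * d j)) = 0" .
    qed
    then have "\<forall>j<n. (t j e - t n e) * d j = 0" using Suc.IH[of "\<lambda>j. (t j e - t n e) * d j"] Suc.prems(1) by simp
    then have d0: "d j = 0" if "j < n" for j using t_ne[of j n] Suc.prems(1) that by auto
    have "(\<Sum>j<Suc n. t j 1 * d j) = 0" using Suc.prems(2) L1(1) by blast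
    then have "d n = 0" using d0 by (simp add: t_one)
    then show ?case using d0 by (simp add: less_Suc_eq)
  qed simp
  define N where "N y = rec_nat 1 (\<lambda>j z. z * t j y)" for y
  have N0: "N y 0 = 1" and NS: "N y (Suc j) = N y j * t j y" for y j by (simp_all add: N_def)
  have N_L: "N y j \<in> L" if "y \<in> L" for y j
    by (induction j) (use that L1 L_mult t_L in \<open>auto simp: N0 NS\<close>)
  have N_pow: "(y * a) ^ j = N y j * a ^ j" for y j
  proof (induction j)
    case (Suc j)
    have "(y * a) ^ Suc j = N y j * (a ^ j * y) * a" by (simp only: power_Suc2 Suc mult.assoc)
    then show ?case unfolding t_a NS by (simp only: power_Suc2 mult.assoc)
  qed (simp add: N0)
  have N_mult: "N (x * y) j = N x j * N y j" if "x \<in> L" "y \<in> L" for x y j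
  proof (induction j)
    case (Suc j)
    have "N y j * t j x = t j x * N y j" using Lc N_L t_L that by blast
    then show ?case by (simp add: NS Suc t_mult mult.assoc) (simp flip: mult.assoc)
  qed (simp add: N0)
  have t_0: "t j y \<noteq> 0" if "y \<noteq> 0" for j y using that a0 by (simp add: t_def)
  have N_0: "N y j \<noteq> 0" if "y \<noteq> 0" for y j
    by (induction j) (use that t_0 in \<open>auto simp: N0 NS\<close>)
  define G where "G = L - {0}"
  define F where "F = {y \<in> G. t 1 y = y}"
  have finG: "finite G" unfolding G_def using fin finite_subset[of L A] by (auto simp: L_def)
  have G: "0 \<notin> G" "\<And>x y. x \<in> G \<Longrightarrow> y \<in> G \<Longrightarrow> x * y \<in> G" "\<And>x. x \<in> G \<Longrightarrow> inverse x \<in> G"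
    using L_mult L_inv by (auto simp: G_def)
  have t1F: "t 1 y = y \<longleftrightarrow> a * y = y * a" for y
  proof -
    have "a * y = t 1 y * a" using t_a[of 1 y] by simp
    then show ?thesis using a0 by simp
  qed
  have NF: "N y k \<in> F" if "y \<in> G" for y
  proof -
    have y: "y \<in> L" "y \<noteq> 0" using that by (auto simp: G_def)
    have "(y * a) * (N y k * b) = (N y k * b) * (y * a)"
      unfolding b_def N_pow[symmetric] by (simp add: power_commutes)
    also have "\<dots> = N y k * ((b * y) * a)" by (simp add: mult.assoc)
    also have "b * y = y * b" using Lc L1 y by blast
    also have "N y k * (y * b * a) = y * N y k * a * b"
      using Lc[OF N_L[OF y(1)] y(1)] ba by (metis mult.assoc)
    finally have "y * (a * N y k) * b = y * (N y k * a) * b" by (simp add: mult.assoc)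
    then have "a * N y k = N y k * a" using y b0 by simp
    then show ?thesis using t1F N_0 N_L y by (simp add: F_def G_def)
  qed
  define f where "f z = z * inverse (t 1 z)" for z
  have f_hom: "f (x * y) = f x * f y" if "x \<in> G" "y \<in> G" for x y
  proof -
    have L: "x \<in> L" "y \<in> L" "x \<noteq> 0" "y \<noteq> 0" using that by (auto simp: G_def)
    have "f (x * y) = x * (y * inverse (t 1 y)) * inverse (t 1 x)"
      using t_0 L by (simp add: f_def t_mult nonzero_inverse_mult_distrib mult.assoc)
    also have "\<dots> = f x * f y"
      unfolding f_def using Lc[of "y * inverse (t 1 y)" "inverse (t 1 x)"] L L_mult L_inv t_L
      by (simp add: mult.assoc)
    finally show ?thesis .
  qed
  have f_0: "f x \<noteq> 0" if "x \<in> G" for x using that t_0 by (auto simp: f_def G_def)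
  have f_ker: "{x \<in> G. f x = 1} = F"
  proof -
    have "f x = 1 \<longleftrightarrow> t 1 x = x" if "x \<in> G" for x
    proof -
      have x: "t 1 x \<noteq> 0" using that t_0 by (auto simp: G_def)
      have "f x * t 1 x = x" unfolding f_def using x by (simp add: mult.assoc)
      then show ?thesis using x by (auto simp: f_def)
    qed
    then show ?thesis by (auto simp: F_def)
  qed
  \<comment> \<open>Elements of norm 1 are of the form \<open>z * inverse (t 1 z)\<close>; \<open>z\<close> is a nonzero value of the resolvent \<open>Z\<close>.\<close>
  have hilbert90: "{y \<in> G. N y k = 1} \<subseteq> f ` G"
  proof
    fix y assume "y \<in> {y \<in> G. N y k = 1}"
    then have y: "y \<in> L" "y \<noteq> 0" "N y k = 1" by (auto simp: G_def)
    define Z where "Z x = (\<Sum>j<k. N y j * t j x)" for x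
    have Z_r: "y * t 1 (Z x) = Z x" if x: "x \<in> L" for x
    proof -
      have 1: "y * t 1 (N y j * t j x) = N y (Suc j) * t (Suc j) x" for j
      proof -
        have "N y (Suc j) * a ^ Suc j = y * (a * N y j) * a ^ j"
          using N_pow[of y "Suc j"] by (simp only: power_Suc N_pow mult.assoc)
        also have "a * N y j = t 1 (N y j) * a" using t_a[of 1] by simp
        also have "y * (t 1 (N y j) * a) * a ^ j = y * t 1 (N y j) * a ^ Suc j"
          by (simp only: power_Suc mult.assoc)
        finally have "N y (Suc j) * a ^ Suc j = y * t 1 (N y j) * a ^ Suc j" .
        then have "N y (Suc j) = y * t 1 (N y j)" using a0 by simp
        then show ?thesis by (simp only: t_mult t_Suc[of j x] mult.assoc)
      qed
      have "t 1 (Z x) = (\<Sum>j<k. t 1 (N y j * t j x))"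
        by (simp add: Z_def t_def sum_distrib_left sum_distrib_right)
      then have "y * t 1 (Z x) = (\<Sum>j<k. N y (Suc j) * t (Suc j) x)"
        by (simp only: sum_distrib_left 1)
      also have "\<dots> = Z x + N y k * t k x - N y 0 * t 0 x"
        unfolding Z_def using sum.lessThan_Suc_shift[of "\<lambda>j. N y j * t j x" k] by (simp add: algebra_simps)
      also have "t k x = x"
      proof -
        have "b * x = x * b" using Lc L1 x by blast
        then show ?thesis using b0 by (simp add: t_def mult.assoc flip: b_def)
      qed
      finally show ?thesis by (simp add: y(3) N0 t_def)
    qed
    have "\<exists>x\<in>L. Z x \<noteq> 0"
    proof (rule ccontr)
      assume "\<not> ?thesis"
      moreover have "Z x = (\<Sum>j<k. t j x * N y j)" if "x \<in> L" for x
        unfolding Z_def using Lc N_L t_L y(1) that by (intro sum.cong) auto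
      ultimately have "\<forall>x\<in>L. (\<Sum>j<k. t j x * N y j) = 0" by auto
      then have "N y 0 = 0" using indep[of k "N y"] k(1) by blast
      then show False by (simp add: N0)
    qed
    then obtain x where x: "x \<in> L" "Z x \<noteq> 0" by blast
    have "(\<Sum>j<n. N y j * t j x) \<in> L" for n
    proof (induction n)
      case 0
      show ?case using minus[OF A(1) A(1)] by (simp add: L_def)
    next
      case (Suc n) then show ?case using L_add L_mult N_L t_L x y(1) by simp
    qed
    then have ZG: "Z x \<in> G" using x by (simp add: G_def Z_def)
    have "y = f (Z x)"
    proof -
      have "y * t 1 (Z x) * inverse (t 1 (Z x)) = f (Z x)" by (simp only: Z_r[OF x(1)] f_def)
      moreover have "t 1 (Z x) \<noteq> 0" by (rule t_0[OF x(2)])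
      then have "y * t 1 (Z x) * inverse (t 1 (Z x)) = y" by (simp add: mult.assoc)
      ultimately show ?thesis by (rule trans[OF sym, rotated])
    qed
    then show "y \<in> f ` G" using ZG by blast
  qed
  \<comment> \<open>The kernel of \<open>f\<close> is \<open>F\<close>, and the kernel of the norm lies in the image of \<open>f\<close>; so the image of the norm is at least as large as \<open>F\<close>.\<close>
  have card_f: "card G = card (f ` G) * card F"
    using card_hom_fibres[OF finG G f_hom f_0] f_ker by simp
  have card_N: "card G = card ((\<lambda>y. N y k) ` G) * card {y \<in> G. N y k = 1}"
  proof (rule card_hom_fibres[OF finG G])
    show "N (x * y) k = N x k * N y k" if "x \<in> G" "y \<in> G" for x y
      using N_mult that by (simp add: G_def)
    show "N x k \<noteq> 0" if "x \<in> G" for x using N_0 that by (simp add: G_def)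
  qed
  have "card {y \<in> G. N y k = 1} \<le> card (f ` G)"
    by (rule card_mono[OF _ hilbert90]) (use finG in simp)
  then have "card (f ` G) * card F \<le> card (f ` G) * card ((\<lambda>y. N y k) ` G)"
    unfolding card_f[symmetric] card_N by (simp add: mult.commute)
  moreover have "card (f ` G) > 0" using finG L1(1) by (auto simp: card_gt_0_iff G_def)
  ultimately have "card F \<le> card ((\<lambda>y. N y k) ` G)" by simp
  moreover have "finite F" using finG by (simp add: F_def)
  moreover have "(\<lambda>y. N y k) ` G \<subseteq> F" using NF by blast
  ultimately have surj: "(\<lambda>y. N y k) ` G = F" by (metis card_seteq)
  have "a * inverse b = inverse b * a"
    using ba by (metis mult_commute_imp_mult_inverse_commute)
  then have "inverse b \<in> F" using t1F b0 L_inv L1(3) by (simp add: F_def G_def)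
  then obtain y where y: "y \<in> G" "N y k = inverse b" using surj by (metis imageE)
  define r where "r = y * a"
  have "r ^ k = 1" unfolding r_def N_pow using y b0 by (simp flip: b_def)
  moreover have "r \<noteq> 1"
  proof
    assume "r = 1"
    have yL: "y \<in> L" using y by (simp add: G_def)
    have "y * (a * e) = y * (e * a)"
      using \<open>r = 1\<close> Lc[OF yL L1(2)] unfolding r_def by (metis mult.assoc mult_1_left mult_1_right)
    then show False using nc y by (simp add: G_def)
  qed
  moreover have "(1 - r) * (\<Sum>j<k. r ^ j) = 1 - r ^ k" by (rule geometric_factor)
  ultimately have sum0: "(\<Sum>j<k. r ^ j) = 0" by simp
  have "\<forall>x\<in>L. (\<Sum>j<k. t j x * r ^ j) = 0"
  proof
    fix x assume x: "x \<in> L"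
    have "r ^ j * x = t j x * r ^ j" for j
    proof -
      have "r ^ j * x = N y j * (a ^ j * x)" by (simp add: r_def N_pow mult.assoc)
      also have "\<dots> = (N y j * t j x) * a ^ j" by (simp add: t_a mult.assoc)
      also have "N y j * t j x = t j x * N y j" using Lc N_L t_L x y by (auto simp: G_def)
      finally show ?thesis by (simp add: r_def N_pow mult.assoc)
    qed
    then have "(\<Sum>j<k. t j x * r ^ j) = (\<Sum>j<k. r ^ j) * x" by (simp add: sum_distrib_right)
    then show "(\<Sum>j<k. t j x * r ^ j) = 0" using sum0 by simp
  qed
  then have "r ^ 0 = 0" using indep[of k "\<lambda>j. r ^ j"] k(1) by blast
  then show False by simp
qed

section \<open>Roots of unity twisted by another element\<close>

definition monomials :: "'a::division_ring \<Rightarrow> 'a \<Rightarrow> nat set \<Rightarrow> 'a set" where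
  "monomials e a K = {e ^ j * a ^ k | j k. k \<in> K}"

lemma monomialsI: "k \<in> K \<Longrightarrow> e ^ j * a ^ k \<in> monomials e a K"
  by (auto simp: monomials_def)

lemma monomialsE:
  assumes "x \<in> monomials e a K"
  obtains j k where "x = e ^ j * a ^ k" "k \<in> K"
  using assms by (auto simp: monomials_def)

lemma monomials_mono: "K \<subseteq> L \<Longrightarrow> monomials e a K \<subseteq> monomials e a L"
  by (auto simp: monomials_def)

lemma finite_monomials:
  assumes "finite K" "m > 0" "e ^ m = 1"
  shows "finite (monomials e a K)"
proof -
  have "e ^ j = e ^ (j mod m)" for j
  proof -
    have "e ^ j = (e ^ m) ^ (j div m) * e ^ (j mod m)" by (simp flip: power_mult power_add)
    then show ?thesis by (simp add: assms(3))
  qed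
  note mod = this
  have "monomials e a K \<subseteq> (\<lambda>(j, k). e ^ j * a ^ k) ` ({..<m} \<times> K)"
  proof
    fix x assume "x \<in> monomials e a K"
    then obtain j k where "x = e ^ j * a ^ k" "k \<in> K" by (rule monomialsE)
    then have "x = (\<lambda>(j, k). e ^ j * a ^ k) (j mod m, k)" "(j mod m, k) \<in> {..<m} \<times> K"
      using mod[of j] assms(2) by simp_all
    then show "x \<in> (\<lambda>(j, k). e ^ j * a ^ k) ` ({..<m} \<times> K)" by (rule image_eqI)
  qed
  then show ?thesis using assms(1) finite_subset by blast
qed

lemma zspan_monomials_bounded:
  assumes "x \<in> zs.span (monomials e a UNIV)"
  shows "\<exists>n. x \<in> zs.span (monomials e a {..n})"
  using assms
proof (induction rule: zs.span_induct_alt)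
  case base show ?case by (simp add: zs.span_zero)
next
  case (step c x y)
  obtain j k where x: "x = e ^ j * a ^ k" using step(1) by (rule monomialsE)
  obtain n where y: "y \<in> zs.span (monomials e a {..n})" using step by blast
  have mono: "zs.span (monomials e a {..i}) \<subseteq> zs.span (monomials e a {..max n k})" if "i \<le> max n k" for i
    using that by (intro zs.span_mono monomials_mono) auto
  have "x \<in> zs.span (monomials e a {..k})" unfolding x by (intro zs.span_base monomialsI) simp
  then have "x \<in> zs.span (monomials e a {..max n k})" using mono[of k] by auto
  moreover have "y \<in> zs.span (monomials e a {..max n k})" using mono[of n] y by auto
  ultimately show ?case using zs.span_add zs.span_scale by blast
qed

lemma span_mult_left_pow:
  assumes "x \<in> zs.span (monomials e a K)"
  shows "e ^ j * x \<in> zs.span (monomials e a K)"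
proof (rule zspan_mult[OF zs.span_base assms])
  show "e ^ j \<in> {e ^ j}" by simp
  fix s t assume "s \<in> {e ^ j}" "t \<in> monomials e a K"
  then obtain j' k where "t = e ^ j' * a ^ k" "k \<in> K" "s = e ^ j" by (auto elim: monomialsE)
  then show "s * t \<in> zs.span (monomials e a K)"
    using monomialsI[of k K e "j + j'" a] by (simp add: power_add mult.assoc zs.span_base)
qed

lemma span_mult_right_pow:
  assumes x: "x \<in> zs.span (monomials e a K)" and "\<And>k. k \<in> K \<Longrightarrow> a ^ k * b \<in> monomials e c M"
  shows "x * b \<in> zs.span (monomials e c M)"
proof (rule zspan_mult[OF x zs.span_base])
  show "b \<in> {b}" by simp
  fix s t assume "s \<in> monomials e a K" "t \<in> {b}"
  then obtain j k where s: "s = e ^ j * a ^ k" "k \<in> K" and t: "t = b" by (auto elim: monomialsE)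
  obtain j' k' where "a ^ k * b = e ^ j' * c ^ k'" "k' \<in> M" using assms(2)[OF s(2)] by (rule monomialsE)
  then have "s * t = e ^ (j + j') * c ^ k'" by (simp add: s t power_add mult.assoc)
  then show "s * t \<in> zs.span (monomials e c M)"
    using monomialsI[OF \<open>k' \<in> M\<close>, of e "j + j'" c] by (simp add: zs.span_base)
qed

lemma inverse_power_cancel:
  fixes a :: "'a::division_ring"
  assumes "a \<noteq> 0"
  shows "l \<le> k \<Longrightarrow> inverse a ^ l * a ^ k = a ^ (k - l)"
proof -
  assume "l \<le> k"
  then have "a ^ k = a ^ l * a ^ (k - l)" by (simp flip: power_add)
  then show ?thesis using assms by (simp add: power_inverse flip: mult.assoc)
qed

text \<open>Chevalley's argument: write $1 = 2x$ with $x$ of degree at most $p$ in $a$, and $1 = 2y$ with $y$ of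
degree at most $q$ in $a^{-1}$. The span $M$ of the monomials of degree at most $p + q$ in $a$ satisfies
$M = 2M$: multiply monomials of degree at most $q$ by $x$ and the others by $y$. This contradicts
Nakayama's lemma.\<close>

lemma two_not_unit:
  fixes e a :: "'a::division_ring"
  assumes char0: "\<And>n. n > 0 \<Longrightarrow> of_nat n \<noteq> (0::'a)" and m: "m > 0" "e ^ m = 1" and a0: "a \<noteq> 0"
    and x: "x \<in> zs.span (monomials e a UNIV)" and y: "y \<in> zs.span (monomials e (inverse a) UNIV)"
  shows "2 * x \<noteq> 1 \<or> 2 * y \<noteq> 1"
proof (rule ccontr)
  assume "\<not> ?thesis"
  then have xy: "2 * x = 1" "2 * y = 1" by auto
  obtain p where p: "x \<in> zs.span (monomials e a {..p})" using zspan_monomials_bounded[OF x] by blast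
  obtain q where q: "y \<in> zs.span (monomials e (inverse a) {..q})" using zspan_monomials_bounded[OF y] by blast
  define G where "G = monomials e a {..p + q}"
  have half: "2 * (e ^ j * z * a ^ k) = e ^ j * a ^ k" if "2 * z = 1" for z j k
  proof -
    have "2 * (e ^ j * z * a ^ k) = e ^ j * (2 * z) * a ^ k"
      by (metis mult.assoc mult_of_nat_commute of_nat_numeral)
    then show ?thesis by (simp add: that)
  qed
  have "G \<subseteq> {0}"
  proof (rule two_divisible_span_trivial)
    show "of_nat n \<noteq> (0::'a)" if "n > 0" for n using char0 that .
    show "finite G" unfolding G_def using m by (simp add: finite_monomials)
    fix g assume "g \<in> G"
    then obtain j k where g: "g = e ^ j * a ^ k" "k \<le> p + q" unfolding G_def by (auto elim: monomialsE)
    have "\<exists>h\<in>zs.span G. g = 2 * h"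
    proof (cases "k \<le> q")
      case True
      have "e ^ j * x * a ^ k \<in> zs.span G"
        unfolding G_def
      proof (rule span_mult_right_pow[OF span_mult_left_pow[OF p]])
        fix l assume "l \<in> {..p}"
        then show "a ^ l * a ^ k \<in> monomials e a {..p + q}"
          using monomialsI[of "l + k" "{..p + q}" e 0 a] True by (simp add: power_add)
      qed
      then show ?thesis using half[OF xy(1)] g(1) by metis
    next
      case False
      have "e ^ j * y * a ^ k \<in> zs.span G"
        unfolding G_def
      proof (rule span_mult_right_pow[OF span_mult_left_pow[OF q]])
        fix l assume "l \<in> {..q}"
        then show "inverse a ^ l * a ^ k \<in> monomials e a {..p + q}"
          using monomialsI[of "k - l" "{..p + q}" e 0 a] False g(2) a0 by (simp add: inverse_power_cancel)
      qed
      then show ?thesis using half[OF xy(2)] g(1) by metis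
    qed
    then obtain h where "h \<in> zs.span G" "g = 2 * h" by blast
    then have "odd (1::int) \<and> h \<in> zs.span G \<and> of_int 1 * g = 2 * h" by simp
    then show "\<exists>c h. odd c \<and> h \<in> zs.span G \<and> of_int c * g = 2 * h" by blast
  qed
  moreover have "1 \<in> G" unfolding G_def using monomialsI[of 0 "{..p + q}" e 0 a] by simp
  ultimately show False by auto
qed

lemma finite_zspan:
  fixes G :: "'a::division_ring set"
  assumes "p > 0" "of_nat p = (0::'a)" "finite G"
  shows "finite (zs.span G)"
  using assms(3)
proof (induction G)
  case (insert g G)
  have "zs.span (insert g G) \<subseteq> (\<lambda>(n, k). of_int n * g + k) ` ({0..<int p} \<times> zs.span G)"
  proof
    fix h assume "h \<in> zs.span (insert g G)"
    then obtain n where n: "h - of_int n * g \<in> zs.span G" by (auto simp: zs.span_insert)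
    have "of_int n = (of_int (int p * (n div int p) + n mod int p) :: 'a)" by simp
    also have "\<dots> = of_int (n mod int p)" using assms(2) by (simp only: of_int_add of_int_mult of_int_of_nat_eq) simp
    finally have "h = of_int (n mod int p) * g + (h - of_int n * g)" by simp
    moreover have "n mod int p \<in> {0..<int p}" using assms(1) by simp
    ultimately show "h \<in> (\<lambda>(n, k). of_int n * g + k) ` ({0..<int p} \<times> zs.span G)" using n by force
  qed
  then show ?case using insert.IH finite_subset by blast
qed simp

locale twisted_pair =
  fixes e a :: "'a::division_ring" and m i :: nat
  assumes order: "m > 0" "e ^ m = 1" and a0: "a \<noteq> 0" and twist: "a * e = e ^ i * a"
begin

lemma pow_twist: "a ^ k * e ^ j = e ^ (j * i ^ k) * a ^ k"
proof (induction k)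
  case (Suc k)
  have 1: "a * e ^ j = e ^ (j * i) * a" for j
  proof (induction j)
    case (Suc j)
    have "a * e ^ Suc j = e ^ (j * i) * (a * e)" by (simp only: power_Suc2 Suc mult.assoc flip: mult.assoc[of a])
    then show ?case by (simp only: twist power_add mult.assoc mult_Suc add.commute[of i])
  qed simp
  have "a ^ Suc k * e ^ j = a * (a ^ k * e ^ j)" by (simp add: mult.assoc)
  also have "\<dots> = (a * e ^ (j * i ^ k)) * a ^ k" by (simp only: Suc mult.assoc)
  also have "\<dots> = e ^ (j * i ^ Suc k) * a ^ Suc k" by (simp add: 1 mult.assoc mult.commute[of i])
  finally show ?case .
qed simp

lemma e0: "e \<noteq> 0" using order by (auto simp: power_0_left)

lemma central_power: "\<exists>k>0. a ^ k * e = e * a ^ k"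
proof -
  have "range (\<lambda>k. e ^ (i ^ k)) \<subseteq> monomials e 1 {0}"
    using monomialsI[of 0 "{0}" e _ 1] by auto
  then have "\<not> inj (\<lambda>k. e ^ (i ^ k))"
    using finite_monomials[OF _ order, of "{0}" 1] finite_imageD finite_subset infinite_UNIV_nat
    by (metis finite.emptyI finite.insertI)
  then obtain p q where pq: "p < q" "e ^ (i ^ p) = e ^ (i ^ q)" by (metis (mono_tags) injI linorder_neqE_nat)
  have aq: "a ^ q = a ^ p * a ^ (q - p)" using pq(1) by (simp flip: power_add)
  have "a ^ p * (a ^ (q - p) * e) = e ^ (i ^ q) * a ^ q"
    using pow_twist[of q 1] unfolding aq by (simp add: mult.assoc)
  also have "\<dots> = (e ^ (i ^ p) * a ^ p) * a ^ (q - p)" by (simp only: pq(2) aq mult.assoc)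
  also have "e ^ (i ^ p) * a ^ p = a ^ p * e" using pow_twist[of p 1] by simp
  also have "a ^ p * e * a ^ (q - p) = a ^ p * (e * a ^ (q - p))" by (rule mult.assoc)
  finally have "a ^ (q - p) * e = e * a ^ (q - p)" using a0 by simp
  then show ?thesis using pq(1) by (intro exI[of _ "q - p"]) simp
qed

lemma inverse_pair: "\<exists>i'. twisted_pair e (inverse a) m i'"
proof -
  obtain k where k: "k > 0" "a ^ k * e = e * a ^ k" using central_power by blast
  obtain k' where k': "k = Suc k'" using k(1) gr0_implies_Suc by blast
  have "a * (inverse a * e) * a ^ k = a * (e ^ (i ^ k') * inverse a) * a ^ k"
  proof -
    have "a * (inverse a * e) * a ^ k = a ^ k * e" using a0 k(2) by (simp flip: mult.assoc)
    also have "\<dots> = a * (a ^ k' * e ^ 1)" by (simp add: k' mult.assoc)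
    also have "\<dots> = a * (e ^ (i ^ k') * (inverse a * a ^ k))"
      unfolding pow_twist using a0 by (simp add: k' flip: mult.assoc)
    finally show ?thesis by (simp add: mult.assoc)
  qed
  then have "inverse a * e = e ^ (i ^ k') * inverse a" using a0 by simp
  then have "twisted_pair e (inverse a) m (i ^ k')"
    using order a0 by unfold_locales auto
  then show ?thesis ..
qed

abbreviation "A \<equiv> zs.span (monomials e a UNIV)"

lemma A_mult: "x \<in> A \<Longrightarrow> y \<in> A \<Longrightarrow> x * y \<in> A"
proof (erule (1) zspan_mult)
  fix s t assume "s \<in> monomials e a UNIV" "t \<in> monomials e a UNIV"
  then obtain j k j' k' where "s = e ^ j * a ^ k" "t = e ^ j' * a ^ k'" by (auto elim!: monomialsE)
  then have "s * t = e ^ j * (a ^ k * e ^ j') * a ^ k'" by (simp add: mult.assoc)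
  also have "\<dots> = e ^ (j + j' * i ^ k) * a ^ (k + k')"
    unfolding pow_twist by (simp add: power_add mult.assoc)
  finally show "s * t \<in> A" by (simp add: monomialsI zs.span_base)
qed

lemma A_powers: "e ^ j \<in> A" "a ^ k \<in> A" "1 \<in> A" "e \<in> A" "a \<in> A"
  using monomialsI[of 0 UNIV e j a] monomialsI[of k UNIV e 0 a] monomialsI[of 0 UNIV e 0 a]
    monomialsI[of 0 UNIV e 1 a] monomialsI[of 1 UNIV e 0 a]
  by (simp_all add: zs.span_base)

text \<open>The left ideal $A a$ is two-sided by this rule.\<close>

lemma A_conj: "x \<in> A \<Longrightarrow> \<exists>y\<in>A. a * x = y * a"
proof (induction rule: zs.span_induct_alt)
  case base show ?case using zs.span_zero by (intro bexI[of _ 0]) auto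
next
  case (step c x y)
  obtain j k where x: "x = e ^ j * a ^ k" using step(1) by (rule monomialsE)
  obtain z where z: "z \<in> A" "a * y = z * a" using step by blast
  have "a * x = (a ^ 1 * e ^ j) * a ^ k" by (simp add: x mult.assoc)
  also have "\<dots> = e ^ (j * i) * a ^ k * a"
    unfolding pow_twist by (simp add: mult.assoc power_commutes)
  finally have ax: "a * x = e ^ (j * i) * a ^ k * a" .
  have "a * (of_int c * x) = of_int c * (a * x)" by (metis mult.assoc mult_of_int_commute)
  then have "a * (of_int c * x + y) = (of_int c * (e ^ (j * i) * a ^ k) + z) * a"
    by (simp add: distrib_left distrib_right ax z(2) mult.assoc)
  moreover have "of_int c * (e ^ (j * i) * a ^ k) + z \<in> A"
    by (intro zs.span_add zs.span_scale z(1) zs.span_base monomialsI UNIV_I)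
  ultimately show ?case by blast
qed

lemma commutator_eq: 
  obtains j where "e * a = e ^ j * a * e"
proof
  have "a * e ^ (m - 1) = e ^ ((m - 1) * i) * a" using pow_twist[of 1 "m - 1"] by simp
  then have "e * a * (e ^ (m - 1) * e) = e ^ (1 + (m - 1) * i) * a * e" by (simp add: mult.assoc) (simp flip: mult.assoc)
  moreover have "e ^ (m - 1) * e = 1" using order by (metis power_minus_mult)
  ultimately show "e * a = e ^ (1 + (m - 1) * i) * a * e" by simp
qed

text \<open>The commutator $[e, 1 + v]$ with $v = r a$ equals $(1 + e^j v)(1 + v)^{-1}$, since $e$ scales $v$ by $e^j$.\<close>

lemma prime_in_ideal:
  assumes nc: "a * e \<noteq> e * a"
    and tors: "\<And>v. v \<noteq> 0 \<Longrightarrow> \<exists>n>0. (e * v * inverse e * inverse v) ^ n = 1"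
    and I: "I \<subseteq> A" "0 \<in> I" "\<And>x y. x \<in> I \<Longrightarrow> y \<in> I \<Longrightarrow> x + y \<in> I" "\<And>x. x \<in> I \<Longrightarrow> - x \<in> I"
      "\<And>x y. x \<in> A \<Longrightarrow> y \<in> I \<Longrightarrow> x * y \<in> I" "\<And>x y. x \<in> I \<Longrightarrow> y \<in> A \<Longrightarrow> x * y \<in> I"
    and r: "of_nat r * a \<in> I" "of_nat r \<noteq> (0::'a)"
  shows "\<exists>q. prime q \<and> of_nat q \<noteq> (0::'a) \<and> of_nat q \<in> I"
proof -
  obtain j where j: "e * a = e ^ j * a * e" by (rule commutator_eq)
  obtain k where k: "k > 0" "a ^ k * e = e * a ^ k" using central_power by blast
  define v where "v = of_nat r * a"
  have ev: "e * v = e ^ j * v * e"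
    unfolding v_def using j by (metis mult.assoc mult_of_nat_commute)
  have ev': "e * v \<noteq> v * e"
  proof
    assume "e * v = v * e"
    then have "of_nat r * (e * a) = of_nat r * (a * e)"
      unfolding v_def by (metis mult.assoc mult_of_nat_commute)
    then show False using nc r(2) by simp
  qed
  have v1: "1 + v \<noteq> 0"
  proof
    assume "1 + v = 0"
    then have "v = - 1" by (metis minus_unique)
    then show False using ev' by simp
  qed
  define w where "w = (1 + e ^ j * v) * inverse (1 + v)"
  have "e * (1 + v) * inverse e = 1 + e ^ j * v"
  proof -
    have "e * (1 + v) = (1 + e ^ j * v) * e" by (simp add: distrib_left distrib_right ev)
    then show ?thesis using e0 by (simp add: mult.assoc)
  qed
  then have w: "w = e * (1 + v) * inverse e * inverse (1 + v)" by (simp add: w_def)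
  then obtain n where n: "n > 0" "w ^ n = 1" using tors[OF v1] by blast
  have "w \<noteq> 1"
  proof
    assume "w = 1"
    then have "(1 + e ^ j * v) * inverse (1 + v) * (1 + v) = 1 + v" by (simp add: w_def)
    then have "e ^ j * v = v" using v1 by (simp add: mult.assoc)
    then show False using ev ev' by simp
  qed
  have "v ^ k = of_nat r ^ k * a ^ k"
    unfolding v_def by (rule power_mult_commuting) (rule mult_of_nat_commute)
  then have "v ^ k * e = e * v ^ k"
    using k(2) by (metis mult.assoc mult_of_nat_commute of_nat_power)
  then have vk: "v ^ k * e ^ j = e ^ j * v ^ k"
    using power_commuting_commutes[of e "v ^ k" j] by simp
  show ?thesis
    by (rule unipotent_torsion[of A I "e ^ j" v k w n])
      (use A_powers zs.span_add I r(1) k(1) vk v1 w_def \<open>w \<noteq> 1\<close> n in \<open>simp_all flip: v_def\<close>)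
qed

text \<open>The ideal is $4A$ and not $2A$: with the prime $q = 2$ the relation $2 \in 2A$ would be empty, whereas
$2 \in 4A$ can be divided by $2$.\<close>

lemma char0_half:
  assumes nc: "a * e \<noteq> e * a"
    and tors: "\<And>v. v \<noteq> 0 \<Longrightarrow> \<exists>n>0. (e * v * inverse e * inverse v) ^ n = 1"
    and char0: "\<And>n. n > 0 \<Longrightarrow> of_nat n \<noteq> (0::'a)"
  shows "\<exists>x\<in>A. 2 * x = 1"
proof -
  define I where "I = {4 * x | x. x \<in> A}"
  have IA: "4 * x \<in> A" if "x \<in> A" for x using zs.span_scale[OF that, of 4] by simp
  have 4: "4 * (x * y) = x * (4 * y)" for x y :: 'a
    by (metis mult.assoc mult_of_nat_commute of_nat_numeral)
  have "\<exists>q. prime q \<and> of_nat q \<noteq> (0::'a) \<and> of_nat q \<in> I"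
  proof (rule prime_in_ideal[OF nc tors, of I 4])
    show "I \<subseteq> A" using IA by (auto simp: I_def)
    show "0 \<in> I" unfolding I_def using zs.span_zero by force
    show "x + y \<in> I" if "x \<in> I" "y \<in> I" for x y
    proof -
      obtain x' y' where "x = 4 * x'" "y = 4 * y'" "x' \<in> A" "y' \<in> A" using \<open>x \<in> I\<close> \<open>y \<in> I\<close> by (auto simp: I_def)
      then have "x + y = 4 * (x' + y')" "x' + y' \<in> A" by (simp_all add: distrib_left zs.span_add)
      then show ?thesis unfolding I_def by blast
    qed
    show "- x \<in> I" if "x \<in> I" for x
    proof -
      obtain x' where "x = 4 * x'" "x' \<in> A" using \<open>x \<in> I\<close> by (auto simp: I_def)
      then have "- x = 4 * (- x')" "- x' \<in> A" by (simp_all add: zs.span_neg)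
      then show ?thesis unfolding I_def by blast
    qed
    show "x * y \<in> I" if "x \<in> A" "y \<in> I" for x y
      using that A_mult 4 unfolding I_def by (auto simp flip: 4)
    show "x * y \<in> I" if "x \<in> I" "y \<in> A" for x y
      using that A_mult unfolding I_def by (auto simp: mult.assoc)
    show "of_nat 4 * a \<in> I" unfolding I_def using A_powers(5) by auto
    show "of_nat 4 \<noteq> (0::'a)" by (rule char0) simp
  qed
  then obtain q x where q: "prime q" and x: "x \<in> A" "of_nat q = 4 * x" by (auto simp: I_def)
  have two: "(2::'a) \<noteq> 0" using char0[of 2] by simp
  show ?thesis
  proof (cases "q = 2")
    case True
    then have "2 * (2 * x - 1) = 0" using x(2) by (simp add: right_diff_distrib flip: mult.assoc)
    then have "2 * x - 1 = 0" using two by (simp only: mult_eq_0_iff) simp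
    then show ?thesis using x(1) by auto
  next
    case False
    then have "odd q" using q primes_dvd_imp_eq two_is_prime_nat by blast
    then obtain r where "q = 2 * r + 1" by (rule oddE)
    then have "1 + 2 * of_nat r = 4 * x" using x(2) by (simp add: add.commute)
    then have "2 * (2 * x - of_nat r) = 1"
      by (simp add: right_diff_distrib flip: mult.assoc) (simp add: diff_eq_eq)
    moreover have "2 * x - of_nat r \<in> A"
      using zs.span_diff[OF zs.span_scale[OF x(1), of 2] zs.span_scale[OF A_powers(3), of "int r"]] by simp
    ultimately show ?thesis by blast
  qed
qed

text \<open>The prime that is found in $A a$ is not the characteristic, so it is invertible in $A$ and
$1 \in A a$.\<close>

lemma charp_inverse:
  assumes nc: "a * e \<noteq> e * a"
    and tors: "\<And>v. v \<noteq> 0 \<Longrightarrow> \<exists>n>0. (e * v * inverse e * inverse v) ^ n = 1"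
    and p: "prime p" "of_nat p = (0::'a)"
  shows "inverse a \<in> A"
proof -
  define I where "I = {x * a | x. x \<in> A}"
  have I_mult: "x * y \<in> I" if "x \<in> A" "y \<in> I" for x y
  proof -
    obtain y' where "y = y' * a" "y' \<in> A" using \<open>y \<in> I\<close> by (auto simp: I_def)
    then have "x * y = (x * y') * a" "x * y' \<in> A" using A_mult \<open>x \<in> A\<close> by (simp_all add: mult.assoc)
    then show ?thesis unfolding I_def by blast
  qed
  have "\<exists>q. prime q \<and> of_nat q \<noteq> (0::'a) \<and> of_nat q \<in> I"
  proof (rule prime_in_ideal[OF nc tors, of I 1])
    show "I \<subseteq> A" using A_mult A_powers(5) by (auto simp: I_def)
    show "0 \<in> I" unfolding I_def using zs.span_zero by force
    show "x + y \<in> I" if "x \<in> I" "y \<in> I" for x y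
    proof -
      obtain x' y' where "x = x' * a" "y = y' * a" "x' \<in> A" "y' \<in> A" using \<open>x \<in> I\<close> \<open>y \<in> I\<close> by (auto simp: I_def)
      then have "x + y = (x' + y') * a" "x' + y' \<in> A" by (simp_all add: distrib_right zs.span_add)
      then show ?thesis unfolding I_def by blast
    qed
    show "- x \<in> I" if "x \<in> I" for x
    proof -
      obtain x' where "x = x' * a" "x' \<in> A" using \<open>x \<in> I\<close> by (auto simp: I_def)
      then have "- x = (- x') * a" "- x' \<in> A" by (simp_all add: zs.span_neg)
      then show ?thesis unfolding I_def by blast
    qed
    show "x * y \<in> I" if "x \<in> A" "y \<in> I" for x y using I_mult that .
    show "x * y \<in> I" if "x \<in> I" "y \<in> A" for x y
    proof -
      obtain x' where x': "x = x' * a" "x' \<in> A" using \<open>x \<in> I\<close> by (auto simp: I_def)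
      obtain z where z: "z \<in> A" "a * y = z * a" using A_conj[OF \<open>y \<in> A\<close>] by blast
      have "x * y = (x' * z) * a" by (simp only: x' mult.assoc z(2))
      then show ?thesis using A_mult[OF x'(2) z(1)] unfolding I_def by blast
    qed
    show "of_nat 1 * a \<in> I" unfolding I_def using A_powers(3) by force
    show "of_nat 1 \<noteq> (0::'a)" by simp
  qed
  then obtain q where q: "prime q" "of_nat q \<noteq> (0::'a)" "of_nat q \<in> I" by blast
  have "coprime q p" using q(1,2) p primes_coprime by blast
  then have "coprime (int q) (int p)" by simp
  then obtain u v where "u * int q + v * int p = 1"
    using bezout_int[of "int q" "int p"] by auto
  then have "of_int (u * int q + v * int p) = (1::'a)" by simp
  then have "of_int u * of_nat q = (1::'a)" using p(2) by simp
  moreover have "of_int u \<in> A" using zs.span_scale[OF A_powers(3), of u] by simp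
  ultimately have "1 \<in> I" using I_mult[OF _ q(3)] by metis
  then obtain x where x: "x \<in> A" "1 = x * a" by (auto simp: I_def)
  have "x = x * a * inverse a" using a0 by (simp add: mult.assoc)
  then show ?thesis using x by simp
qed

text \<open>If $a$ is a combination of monomials in $e$ and $a^{-1}$ of degree at most $n$ in $a^{-1}$, then
$a^{n+1}$ is a combination of monomials of degree at most $n$ in $a$, so these span $A$.\<close>

lemma finite_if_pole:
  assumes p: "p > 0" "of_nat p = (0::'a)" and a: "a \<in> zs.span (monomials e (inverse a) UNIV)"
  shows "finite A"
proof -
  obtain n where n: "a \<in> zs.span (monomials e (inverse a) {..n})"
    using zspan_monomials_bounded[OF a] by blast
  define M where "M = zs.span (monomials e a {..n})"
  have "a ^ k \<in> M" for k
  proof (induction k)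
    case 0
    then show ?case unfolding M_def using monomialsI[of 0 "{..n}" e 0 a] by (simp add: zs.span_base)
  next
    case (Suc k)
    have "a ^ k * a \<in> zs.span (monomials e a {..n})"
      using Suc unfolding M_def
    proof (rule zspan_mult[OF _ zs.span_base])
      show "a \<in> {a}" by simp
      fix s t assume "s \<in> monomials e a {..n}" "t \<in> {a}"
      then obtain j l where s: "s = e ^ j * a ^ l" "l \<le> n" and t: "t = a" by (auto elim: monomialsE)
      show "s * t \<in> zs.span (monomials e a {..n})"
      proof (cases "l = n")
        case True
        have "e ^ j * (a * a ^ n) \<in> zs.span (monomials e a {..n})"
        proof (intro span_mult_left_pow span_mult_right_pow[OF n])
          fix k assume "k \<in> {..n}"
          then show "inverse a ^ k * a ^ n \<in> monomials e a {..n}"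
            using monomialsI[of "n - k" "{..n}" e 0 a] a0 by (simp add: inverse_power_cancel)
        qed
        then show ?thesis by (simp add: s t True mult.assoc power_commutes)
      next
        case False
        then show ?thesis using s t monomialsI[of "Suc l" "{..n}" e j a]
          by (simp add: mult.assoc power_commutes zs.span_base)
      qed
    qed
    then show ?case by (simp add: M_def power_commutes)
  qed
  then have "e ^ j * a ^ k \<in> M" for j k unfolding M_def by (intro span_mult_left_pow)
  then have "A \<subseteq> M" unfolding M_def by (intro zs.span_minimal) (auto elim: monomialsE)
  moreover have "finite M"
    unfolding M_def using finite_zspan[OF p] finite_monomials[OF _ order] by blast
  ultimately show ?thesis using finite_subset by blast
qed

lemma torsion_commutators_commute:
  assumes tors: "\<And>v. v \<noteq> 0 \<Longrightarrow> \<exists>n>0. (e * v * inverse e * inverse v) ^ n = 1"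
  shows "a * e = e * a"
proof (rule ccontr)
  assume nc: "a * e \<noteq> e * a"
  obtain i' where "twisted_pair e (inverse a) m i'" using inverse_pair by blast
  then interpret inv: twisted_pair e "inverse a" m i' .
  have nc': "inverse a * e \<noteq> e * inverse a"
  proof
    assume "inverse a * e = e * inverse a"
    then have "e * inverse (inverse a) = inverse (inverse a) * e"
      by (metis mult_commute_imp_mult_inverse_commute)
    then show False using nc by (simp add: a0)
  qed
  show False
  proof (cases "\<exists>n>0. of_nat n = (0::'a)")
    case True
    then obtain p where p: "prime p" "of_nat p = (0::'a)" using prime_characteristic by blast
    have "a \<in> zs.span (monomials e (inverse a) UNIV)"
      using inv.charp_inverse[OF nc' tors p] a0 by simp
    then have "finite A" using finite_if_pole[OF prime_gt_0_nat[OF p(1)] p(2)] by blast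
    then show False
      using finite_twisted_commute[of A e a i] A_powers A_mult zs.span_add a0 twist nc by blast
  next
    case False
    then have char0: "of_nat n \<noteq> (0::'a)" if "n > 0" for n using that by blast
    show False
      using char0_half[OF nc tors char0] inv.char0_half[OF nc' tors char0]
        two_not_unit[OF char0 order a0] by blast
  qed
qed

end

section \<open>Radical normal subgroups are central\<close>

lemma common_commuting_power:
  fixes w :: "'a::division_ring"
  assumes "cent_finite TYPE('a)" and "\<And>d. \<exists>n>0. w ^ n * d = d * w ^ n"
  shows "\<exists>n>0. w ^ n \<in> cent"
proof -
  obtain S :: "'a set" where S: "finite S" "cs.span S = UNIV"
    using assms(1) by (auto simp: cent_finite_def)
  have pow: "w ^ (n * k) * d = d * w ^ (n * k)" if "w ^ n * d = d * w ^ n" for n k d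
    using power_commuting_commutes[OF that] by (simp add: power_mult)
  have "\<exists>n>0. \<forall>d\<in>S. w ^ n * d = d * w ^ n"
    using S(1)
  proof (induction S)
    case (insert d S)
    obtain n where n: "n > 0" "\<forall>d\<in>S. w ^ n * d = d * w ^ n" using insert.IH by blast
    obtain k where k: "k > 0" "w ^ k * d = d * w ^ k" using assms(2) by blast
    have "\<forall>d\<in>insert d S. w ^ (n * k) * d = d * w ^ (n * k)"
      using pow[of n _ k] n(2) pow[OF k(2), of n] by (auto simp: mult.commute)
    then show ?case using n(1) k(1) by (intro exI[of _ "n * k"]) simp
  qed auto
  then obtain n where n: "n > 0" "\<forall>d\<in>S. w ^ n * d = d * w ^ n" by blast
  have "w ^ n * d = d * w ^ n" for d
  proof -
    have "d \<in> cs.span S" using S(2) by simp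
    then show ?thesis
    proof (induction rule: cs.span_induct_alt)
      case (step c x y)
      have "w ^ n * cscale c x = cscale c x * w ^ n"
        using n(2) step(1) by (simp add: cscale_mult_right) (simp add: cscale_def mult.assoc)
      then show ?case using step by (simp add: distrib_left distrib_right)
    qed simp
  qed
  then show ?thesis using n(1) by (auto simp: cent_def)
qed

text \<open>If all commutators $z_u = [u, x]$ are central, compare $u x = z_u x u$ with
$(1 + u) x = z_{1+u} x (1 + u)$. If $z_u = z_{1+u}$, then both are $1$; otherwise $u$ is a quotient of
central elements. In both cases $u$ commutes with $x$.\<close>

lemma noncentral_commutator:
  fixes x :: "'a::division_ring"
  assumes "x \<notin> cent"
  shows "\<exists>u. u \<noteq> 0 \<and> u * x * inverse u * inverse x \<notin> cent"
proof (rule ccontr)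
  assume "\<not> ?thesis"
  then have c: "u * x * inverse u * inverse x \<in> cent" if "u \<noteq> 0" for u using that by blast
  have x0: "x \<noteq> 0" using assms by (auto simp: cent_def)
  obtain u where u: "u * x \<noteq> x * u" using assms by (auto simp: cent_def) metis
  have u0: "u \<noteq> 0" "1 + u \<noteq> 0" using u by (auto simp: add_eq_0_iff)
  define z where "z = (\<lambda>u. u * x * inverse u * inverse x)"
  have z: "z v \<in> cent" "v * x = z v * (x * v)" if "v \<noteq> 0" for v
  proof -
    show "z v \<in> cent" using c[OF that] by (simp add: z_def)
    have "inverse x * (x * v) = v" using x0 by (simp flip: mult.assoc)
    then show "v * x = z v * (x * v)" using that by (simp add: z_def mult.assoc)
  qed
  have "z (1 + u) * x + z (1 + u) * (x * u) = x + z u * (x * u)"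
    using z(2)[OF u0(1)] z(2)[OF u0(2)] by (simp add: distrib_left distrib_right)
  then have "(z (1 + u) - 1) * x = (z u - z (1 + u)) * (x * u)"
    by (simp add: algebra_simps)
  moreover have "(z u - z (1 + u)) * (x * u) = (x * ((z u - z (1 + u)) * u))"
  proof -
    define d where "d = z u - z (1 + u)"
    have d: "d * x = x * d"
      using centD[OF z(1)[OF u0(1)], of x] centD[OF z(1)[OF u0(2)], of x]
      by (simp add: d_def left_diff_distrib right_diff_distrib)
    have "d * (x * u) = (d * x) * u" by (simp only: mult.assoc)
    then show ?thesis unfolding d by (simp only: mult.assoc d_def)
  qed
  moreover have "(z (1 + u) - 1) * x = x * (z (1 + u) - 1)"
    using z(1)[OF u0(2)] by (simp add: centD algebra_simps)
  ultimately have eq: "z (1 + u) - 1 = (z u - z (1 + u)) * u" using x0 by simp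
  show False
  proof (cases "z u = z (1 + u)")
    case True
    then have "z u = 1" using eq by simp
    then show False using z(2)[OF u0(1)] u by simp
  next
    case False
    have "(z u - z (1 + u)) * (u * x) = (z (1 + u) - 1) * x" by (simp add: eq mult.assoc)
    also have "\<dots> = (z u - z (1 + u)) * (x * u)" by fact
    finally show False using False u by simp
  qed
qed

theorem radical_normal_central:
  fixes N :: "'a::division_ring set"
  assumes fin: "cent_finite TYPE('a)" and N0: "0 \<notin> N"
    and mult: "\<And>x y. x \<in> N \<Longrightarrow> y \<in> N \<Longrightarrow> x * y \<in> N"
    and inv: "\<And>x. x \<in> N \<Longrightarrow> inverse x \<in> N"
    and conj: "\<And>u x. u \<noteq> 0 \<Longrightarrow> x \<in> N \<Longrightarrow> u * x * inverse u \<in> N"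
    and rad: "\<And>x d. x \<in> N \<Longrightarrow> \<exists>n>0. x ^ n * d = d * x ^ n"
  shows "N \<subseteq> cent"
proof (rule ccontr)
  assume "\<not> N \<subseteq> cent"
  then obtain x where x: "x \<in> N" "x \<notin> cent" by blast
  have torsion: "\<exists>n>0. (u * y * inverse u * inverse y) ^ n = 1"
    if nz: "u \<noteq> 0" "y \<noteq> 0" and w: "u * y * inverse u * inverse y \<in> N" for u y
  proof -
    obtain k where "k > 0" "(u * y * inverse u * inverse y) ^ k \<in> cent"
      using common_commuting_power[OF fin rad[OF w]] by blast
    then show ?thesis using commutator_torsion[OF fin nz] by blast
  qed
  obtain u where u: "u \<noteq> 0" "u * x * inverse u * inverse x \<notin> cent"
    using noncentral_commutator[OF x(2)] by blast
  define e where "e = u * x * inverse u * inverse x"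
  have eN: "e \<in> N" unfolding e_def using mult conj inv u x by blast
  have x0: "x \<noteq> 0" using x N0 by blast
  obtain m where m: "m > 0" "e ^ m = 1" using torsion[OF u(1) x0] eN unfolding e_def by blast
  have "e \<notin> cent" using u(2) by (simp add: e_def)
  then obtain a j where a: "a \<noteq> 0" "e * a = e ^ j * a * e" "e * a \<noteq> a * e"
    using eigenvector[OF m] by blast
  have eq: "e ^ (j * (m - 1)) * e ^ j = (e ^ m) ^ j"
  proof -
    have "j * (m - 1) + j = m * j" using m(1) by (cases m) simp_all
    then show ?thesis by (simp only: flip: power_add power_mult)
  qed
  have "e ^ (j * (m - 1) + 1) * a = a * e"
  proof -
    have "e ^ (j * (m - 1) + 1) * a = e ^ (j * (m - 1)) * (e * a)"
      by (simp only: power_add power_one_right mult.assoc)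
    also have "\<dots> = (e ^ (j * (m - 1)) * e ^ j) * (a * e)" by (simp only: a(2) mult.assoc)
    finally show ?thesis unfolding eq m(2) by simp
  qed
  then interpret twisted_pair e a m "j * (m - 1) + 1"
    by unfold_locales (use m a in auto)
  have "\<exists>n>0. (e * v * inverse e * inverse v) ^ n = 1" if v: "v \<noteq> 0" for v
  proof (rule torsion[OF e0 v])
    have "e * (v * inverse e * inverse v) \<in> N" using mult conj inv v eN by blast
    then show "e * v * inverse e * inverse v \<in> N" by (simp add: mult.assoc)
  qed
  then show False using torsion_commutators_commute a(3) by simp
qed

section \<open>Transfer to rings with a carrier set\<close>

text \<open>The normal subgroups of the unit group, described without \<open>m_inv\<close>. In this form the property
passes to division subrings, where inverses are computed in a smaller carrier.\<close>

definition unit_normal :: "('a, 'b) ring_scheme \<Rightarrow> 'a set \<Rightarrow> bool" where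
  "unit_normal R N \<longleftrightarrow> N \<subseteq> carrier R - {\<zero>\<^bsub>R\<^esub>} \<and>
     (\<forall>x\<in>N. \<forall>y\<in>N. x \<otimes>\<^bsub>R\<^esub> y \<in> N) \<and>
     (\<forall>x\<in>N. \<forall>y\<in>carrier R. x \<otimes>\<^bsub>R\<^esub> y = \<one>\<^bsub>R\<^esub> \<longrightarrow> y \<in> N) \<and>
     (\<forall>x\<in>N. \<forall>g\<in>carrier R. \<forall>h\<in>carrier R. g \<otimes>\<^bsub>R\<^esub> h = \<one>\<^bsub>R\<^esub> \<longrightarrow> g \<otimes>\<^bsub>R\<^esub> x \<otimes>\<^bsub>R\<^esub> h \<in> N)"

definition locally_radical :: "('a, 'b) ring_scheme \<Rightarrow> 'a set \<Rightarrow> bool" where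
  "locally_radical R N \<longleftrightarrow>
     (\<forall>x\<in>N. \<forall>d\<in>carrier R. \<exists>n::nat. n > 0 \<and> x [^]\<^bsub>R\<^esub> n \<otimes>\<^bsub>R\<^esub> d = d \<otimes>\<^bsub>R\<^esub> x [^]\<^bsub>R\<^esub> n)"

text \<open>A theorem about a type class cannot be instantiated with a structure whose carrier is a set in a proof
context. If however the theorem fails for some structure on subsets of \<open>'a\<close>, then one failing
structure can be chosen once and for all, and its carrier becomes a type. If there is no failing
structure, the type is a copy of the rational numbers, so in both cases it is a division ring.\<close>

definition is_counterexample :: "('a, 'b) ring_scheme \<Rightarrow> bool" where
  "is_counterexample R \<longleftrightarrow> centrally_finite R \<and>
     (\<exists>N. unit_normal R N \<and> locally_radical R N \<and> \<not> N \<subseteq> ring_center R)"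

definition counterexample :: "('a, 'b) ring_scheme" where
  "counterexample = (SOME R. is_counterexample R)"

typedef ('a, 'b) ce = "if \<exists>R::('a, 'b) ring_scheme. is_counterexample R
    then Inl ` carrier (counterexample :: ('a, 'b) ring_scheme) else range (Inr :: rat \<Rightarrow> 'a + rat)"
proof (cases "\<exists>R::('a, 'b) ring_scheme. is_counterexample R")
  case True
  then have "is_counterexample (counterexample :: ('a, 'b) ring_scheme)"
    unfolding counterexample_def by (rule someI_ex)
  then interpret skew_field "counterexample :: ('a, 'b) ring_scheme"
    by (simp add: is_counterexample_def centrally_finite_def)
  show ?thesis using True by (intro exI[of _ "Inl \<zero>\<^bsub>counterexample :: ('a, 'b) ring_scheme\<^esub>"]) simp
qed auto

definition is_ce where "is_ce TYPE('a) TYPE('b) \<longleftrightarrow> (\<exists>R::('a, 'b) ring_scheme. is_counterexample R)"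

abbreviation CE :: "('a, 'b) ring_scheme" where "CE \<equiv> counterexample"

definition to_ring :: "('a, 'b) ce \<Rightarrow> 'a" where "to_ring x = projl (Rep_ce x)"
definition of_ring :: "'a \<Rightarrow> ('a, 'b) ce" where "of_ring p = Abs_ce (Inl p)"
definition to_rat :: "('a, 'b) ce \<Rightarrow> rat" where "to_rat x = projr (Rep_ce x)"
definition of_rat_ce :: "rat \<Rightarrow> ('a, 'b) ce" where "of_rat_ce q = Abs_ce (Inr q)"

lemma ce_true:
  assumes "is_ce TYPE('a) TYPE('b)"
  shows "is_counterexample (CE :: ('a, 'b) ring_scheme)"
    and "to_ring (x :: ('a, 'b) ce) \<in> carrier (CE :: ('a, 'b) ring_scheme)"
    and "x = y \<longleftrightarrow> to_ring x = to_ring y"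
    and "p \<in> carrier (CE :: ('a, 'b) ring_scheme) \<Longrightarrow> to_ring (of_ring p :: ('a, 'b) ce) = p"
proof -
  show "is_counterexample (CE :: ('a, 'b) ring_scheme)"
    using assms unfolding counterexample_def is_ce_def by (rule someI_ex)
  have R: "\<exists>p\<in>carrier (CE :: ('a, 'b) ring_scheme). Rep_ce z = Inl p" for z :: "('a, 'b) ce"
    using Rep_ce[of z] assms unfolding is_ce_def by auto
  show "to_ring x \<in> carrier (CE :: ('a, 'b) ring_scheme)" using R[of x] by (auto simp: to_ring_def)
  show "x = y \<longleftrightarrow> to_ring x = to_ring y"
    using R[of x] R[of y] Rep_ce_inject[of x y] by (auto simp: to_ring_def)
  show "to_ring (of_ring p :: ('a, 'b) ce) = p" if "p \<in> carrier (CE :: ('a, 'b) ring_scheme)"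
    unfolding to_ring_def of_ring_def using that assms unfolding is_ce_def
    by (subst Abs_ce_inverse) auto
qed

lemma ce_false:
  assumes "\<not> is_ce TYPE('a) TYPE('b)"
  shows "x = y \<longleftrightarrow> to_rat (x :: ('a, 'b) ce) = to_rat y"
    and "to_rat (of_rat_ce q :: ('a, 'b) ce) = q"
proof -
  have R: "\<exists>q. Rep_ce z = Inr q" for z :: "('a, 'b) ce"
    using Rep_ce[of z] assms unfolding is_ce_def by auto
  show "x = y \<longleftrightarrow> to_rat x = to_rat y"
    using R[of x] R[of y] Rep_ce_inject[of x y] by (auto simp: to_rat_def)
  show "to_rat (of_rat_ce q :: ('a, 'b) ce) = q"
    unfolding to_rat_def of_rat_ce_def using assms unfolding is_ce_def
    by (subst Abs_ce_inverse) auto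
qed

text \<open>The ring operations are defined on both components, of which only the relevant one is kept.\<close>

definition ce_op where
  "ce_op p q = (if is_ce TYPE('a) TYPE('b) then of_ring p else of_rat_ce q :: ('a, 'b) ce)"

lemma ce_op:
  "is_ce TYPE('a) TYPE('b) \<Longrightarrow> p \<in> carrier (CE :: ('a, 'b) ring_scheme) \<Longrightarrow> to_ring (ce_op p q :: ('a, 'b) ce) = p"
  "\<not> is_ce TYPE('a) TYPE('b) \<Longrightarrow> to_rat (ce_op p q :: ('a, 'b) ce) = q"
  by (simp_all add: ce_op_def ce_true ce_false)

instantiation ce :: (type, type) division_ring
begin

definition "0 = (ce_op \<zero>\<^bsub>CE :: ('a, 'b) ring_scheme\<^esub> 0 :: ('a, 'b) ce)"
definition "1 = (ce_op \<one>\<^bsub>CE :: ('a, 'b) ring_scheme\<^esub> 1 :: ('a, 'b) ce)"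
definition "x + y = (ce_op (to_ring x \<oplus>\<^bsub>CE :: ('a, 'b) ring_scheme\<^esub> to_ring y) (to_rat x + to_rat y) :: ('a, 'b) ce)"
definition "- x = (ce_op (\<ominus>\<^bsub>CE :: ('a, 'b) ring_scheme\<^esub> to_ring x) (- to_rat x) :: ('a, 'b) ce)"
definition "x - y = (x + - y :: ('a, 'b) ce)"
definition "x * y = (ce_op (to_ring x \<otimes>\<^bsub>CE :: ('a, 'b) ring_scheme\<^esub> to_ring y) (to_rat x * to_rat y) :: ('a, 'b) ce)"
definition "inverse x = (if x = 0 then 0 else
  ce_op (inv\<^bsub>CE :: ('a, 'b) ring_scheme\<^esub> to_ring x) (inverse (to_rat x)) :: ('a, 'b) ce)"
definition "x div y = (x * inverse y :: ('a, 'b) ce)"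

lemma to_ring_ops:
  fixes x y :: "('a, 'b) ce"
  assumes ce: "is_ce TYPE('a) TYPE('b)"
  shows "to_ring (0 :: ('a, 'b) ce) = \<zero>\<^bsub>CE :: ('a, 'b) ring_scheme\<^esub>"
    and "to_ring (1 :: ('a, 'b) ce) = \<one>\<^bsub>CE :: ('a, 'b) ring_scheme\<^esub>"
    and "to_ring (x + y) = to_ring x \<oplus>\<^bsub>CE :: ('a, 'b) ring_scheme\<^esub> to_ring y"
    and "to_ring (- x) = \<ominus>\<^bsub>CE :: ('a, 'b) ring_scheme\<^esub> to_ring x"
    and "to_ring (x * y) = to_ring x \<otimes>\<^bsub>CE :: ('a, 'b) ring_scheme\<^esub> to_ring y"
    and "x \<noteq> 0 \<Longrightarrow> to_ring x \<in> Units (CE :: ('a, 'b) ring_scheme)"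
    and "x \<noteq> 0 \<Longrightarrow> to_ring (inverse x) = inv\<^bsub>CE :: ('a, 'b) ring_scheme\<^esub> to_ring x"
proof -
  interpret skew_field "CE :: ('a, 'b) ring_scheme"
    using ce_true(1)[OF ce] by (simp add: is_counterexample_def centrally_finite_def)
  note [simp] = ce_op(1)[OF ce] ce_true(2)[OF ce]
  show 0: "to_ring (0 :: ('a, 'b) ce) = \<zero>\<^bsub>CE :: ('a, 'b) ring_scheme\<^esub>"
    by (simp add: zero_ce_def)
  show "to_ring (1 :: ('a, 'b) ce) = \<one>\<^bsub>CE :: ('a, 'b) ring_scheme\<^esub>"
    by (simp add: one_ce_def)
  show "to_ring (x + y) = to_ring x \<oplus>\<^bsub>CE :: ('a, 'b) ring_scheme\<^esub> to_ring y"
    by (simp add: plus_ce_def)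
  show "to_ring (- x) = \<ominus>\<^bsub>CE :: ('a, 'b) ring_scheme\<^esub> to_ring x"
    by (simp add: uminus_ce_def)
  show "to_ring (x * y) = to_ring x \<otimes>\<^bsub>CE :: ('a, 'b) ring_scheme\<^esub> to_ring y"
    by (simp add: times_ce_def)
  show u: "to_ring x \<in> Units (CE :: ('a, 'b) ring_scheme)" if "x \<noteq> 0"
    using that 0 ce_true(3)[OF ce, of x 0] by (simp add: skew_field_Units)
  then show "to_ring (inverse x) = inv\<^bsub>CE :: ('a, 'b) ring_scheme\<^esub> to_ring x" if "x \<noteq> 0"
    using that by (simp add: inverse_ce_def)
qed

lemma to_rat_ops:
  fixes x y :: "('a, 'b) ce"
  assumes ce: "\<not> is_ce TYPE('a) TYPE('b)"
  shows "to_rat (0 :: ('a, 'b) ce) = 0" "to_rat (1 :: ('a, 'b) ce) = 1"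
    "to_rat (x + y) = to_rat x + to_rat y" "to_rat (- x) = - to_rat x"
    "to_rat (x * y) = to_rat x * to_rat y"
    "to_rat (inverse x) = inverse (to_rat x)"
  by (simp_all add: zero_ce_def one_ce_def plus_ce_def uminus_ce_def times_ce_def inverse_ce_def
      ce_op(2)[OF ce])

lemma ce_ring_axioms:
  fixes a b c :: "('a, 'b) ce"
  shows "a * b * c = a * (b * c) \<and> 1 * a = a \<and> a * 1 = a \<and> a + b + c = a + (b + c) \<and> a + b = b + a
    \<and> 0 + a = a \<and> - a + a = 0 \<and> (a + b) * c = a * c + b * c \<and> a * (b + c) = a * b + a * c
    \<and> (0 :: ('a, 'b) ce) \<noteq> 1 \<and> (a \<noteq> 0 \<longrightarrow> inverse a * a = 1 \<and> a * inverse a = 1)"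
proof (cases "is_ce TYPE('a) TYPE('b)")
  case True
  interpret skew_field "CE :: ('a, 'b) ring_scheme"
    using ce_true(1)[OF True] by (simp add: is_counterexample_def centrally_finite_def)
  note [simp] = to_ring_ops(1-5)[OF True] ce_true(2)[OF True]
  have inv: "inverse a * a = 1" "a * inverse a = 1" if "a \<noteq> 0"
    using to_ring_ops(6,7)[OF True that] by (simp_all add: ce_true(3)[OF True])
  show ?thesis
  proof (intro conjI impI)
    show "a + b = b + a" by (simp add: ce_true(3)[OF True] a_comm)
  qed (use inv in \<open>simp_all add: ce_true(3)[OF True] m_assoc a_assoc l_neg l_distr r_distr one_not_zero[symmetric]\<close>)
next
  case False
  note [simp] = to_rat_ops[OF False]
  show ?thesis by (simp add: ce_false(1)[OF False] algebra_simps)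
qed

instance
proof
  fix a b c :: "('a, 'b) ce"
  note ax = ce_ring_axioms[of a b c]
  show "a * b * c = a * (b * c)" "1 * a = a" "a * 1 = a" "a + b + c = a + (b + c)" "a + b = b + a"
    "0 + a = a" "- a + a = 0" "(a + b) * c = a * c + b * c" "a * (b + c) = a * b + a * c"
    "(0 :: ('a, 'b) ce) \<noteq> 1"
    using ax by blast+
  show "inverse a * a = 1" "a * inverse a = 1" if "a \<noteq> 0" using ax that by blast+
  show "a - b = a + - b" by (simp add: minus_ce_def)
  show "inverse (0 :: ('a, 'b) ce) = 0" by (simp add: inverse_ce_def)
  show "a div b = a * inverse b" by (simp add: divide_ce_def)
qed

end

lemma to_ring_power:
  assumes "is_ce TYPE('a) TYPE('b)"
  shows "to_ring ((x :: ('a, 'b) ce) ^ n) = to_ring x [^]\<^bsub>CE :: ('a, 'b) ring_scheme\<^esub> n"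
proof (induction n)
  case 0
  interpret skew_field "CE :: ('a, 'b) ring_scheme"
    using ce_true(1)[OF assms] by (simp add: is_counterexample_def centrally_finite_def)
  show ?case by (simp add: to_ring_ops[OF assms])
next
  case (Suc n)
  interpret skew_field "CE :: ('a, 'b) ring_scheme"
    using ce_true(1)[OF assms] by (simp add: is_counterexample_def centrally_finite_def)
  have "to_ring (x ^ Suc n) = to_ring (x ^ n * x)" by (simp only: power_Suc2)
  then show ?case by (simp add: to_ring_ops(5)[OF assms] Suc)
qed

lemma to_ring_cent:
  assumes ce: "is_ce TYPE('a) TYPE('b)"
  shows "(x :: ('a, 'b) ce) \<in> cent \<longleftrightarrow> to_ring x \<in> ring_center (CE :: ('a, 'b) ring_scheme)"
proof -
  have "x \<in> cent \<longleftrightarrow> (\<forall>y :: ('a, 'b) ce. to_ring x \<otimes>\<^bsub>CE :: ('a, 'b) ring_scheme\<^esub> to_ring y = to_ring y \<otimes>\<^bsub>CE :: ('a, 'b) ring_scheme\<^esub> to_ring x)"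
    by (simp add: cent_def ce_true(3)[OF ce] to_ring_ops[OF ce])
  also have "\<dots> \<longleftrightarrow> to_ring x \<in> ring_center (CE :: ('a, 'b) ring_scheme)"
  proof -
    have "\<exists>y :: ('a, 'b) ce. to_ring y = p" if "p \<in> carrier (CE :: ('a, 'b) ring_scheme)" for p
      using ce_true(4)[OF ce that] by blast
    then show ?thesis unfolding ring_center_def using ce_true(2)[OF ce] by fastforce
  qed
  finally show ?thesis .
qed

lemma ce_cent_finite:
  assumes ce: "is_ce TYPE('a) TYPE('b)"
  shows "cent_finite TYPE(('a, 'b) ce)"
proof -
  define R where "R = (CE :: ('a, 'b) ring_scheme)"
  note [simp] = R_def[symmetric]
  have cf: "centrally_finite R" using ce_true(1)[OF ce] by (simp add: is_counterexample_def)
  interpret skew_field R using cf by (simp add: centrally_finite_def)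
  obtain n where "dimension n (ring_center R) (carrier R)"
    using cf by (auto simp: centrally_finite_def finite_dimension_def)
  then obtain Us where Us: "set Us \<subseteq> carrier R" "Span (ring_center R) Us = carrier R"
    using exists_base[OF ring_center_subfield] by blast
  define f where "f p = (of_ring p :: ('a, 'b) ce)" for p
  have f: "to_ring (f p) = p" if "p \<in> carrier R" for p using ce_true(4)[OF ce] that by (simp add: f_def)
  have f_inv: "f (to_ring x) = x" for x
    using ce_true(3)[OF ce] f ce_true(2)[OF ce] by (simp)
  have C: "set Ks \<subseteq> carrier R" if "set Ks \<subseteq> ring_center R" for Ks
    using that by (auto simp: ring_center_def)
  have "set Ks \<subseteq> ring_center R \<Longrightarrow> set Us \<subseteq> carrier R \<Longrightarrow> f (combine Ks Us) \<in> cs.span (f ` set Us)" for Ks Us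
  proof (induction Ks Us rule: combine.induct)
    case (1 k Ks u Us)
    have k: "k \<in> carrier R" "f k \<in> cent"
      using 1(2) f[of k] to_ring_cent[OF ce, of "f k"] by (auto simp: ring_center_def)
    have u: "u \<in> carrier R" and cm: "combine Ks Us \<in> carrier R" using 1(2,3) C[of Ks] by auto
    have "f (combine (k # Ks) (u # Us)) = f k * f u + f (combine Ks Us)"
      using k u cm by (simp add: ce_true(3)[OF ce] to_ring_ops[OF ce] f)
    also have "f k * f u = cscale (Abs_centre (f k)) (f u)"
      using k(2) by (simp add: cscale_def Abs_centre_inverse)
    finally have eq: "f (combine (k # Ks) (u # Us)) = cscale (Abs_centre (f k)) (f u) + f (combine Ks Us)" .
    have "f (combine Ks Us) \<in> cs.span (f ` set Us)" using 1 by simp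
    then have "f (combine Ks Us) \<in> cs.span (f ` set (u # Us))"
      using cs.span_mono[of "f ` set Us" "f ` set (u # Us)"] by auto
    then show ?case unfolding eq by (intro cs.span_add[OF cs.span_scale[OF cs.span_base]]) auto
  next
    case ("2_1" Us)
    have "f \<zero>\<^bsub>R\<^esub> = 0" by (simp add: ce_true(3)[OF ce] to_ring_ops[OF ce] f)
    then show ?case by (simp add: cs.span_zero)
  next
    case ("2_2" Ks)
    have "f \<zero>\<^bsub>R\<^esub> = 0" by (simp add: ce_true(3)[OF ce] to_ring_ops[OF ce] f)
    then show ?case by (simp add: cs.span_zero)
  qed
  note span = this
  have "x \<in> cs.span (f ` set Us)" for x
  proof -
    have "to_ring x \<in> Span (ring_center R) Us" unfolding Us(2) using ce_true(2)[OF ce] by simp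
    then obtain Ks where "set Ks \<subseteq> ring_center R" "to_ring x = combine Ks Us"
      using Span_eq_combine_set[OF ring_center_subfield Us(1)] by auto
    then show ?thesis using span[OF _ Us(1), of Ks] f_inv[of x] by simp
  qed
  then show ?thesis unfolding cent_finite_def by (intro exI[of _ "f ` set Us"]) auto
qed

text \<open>A counterexample would make the type \<open>ce\<close> a division ring that violates \<open>radical_normal_central\<close>.\<close>

theorem centrally_finite_radical:
  fixes R :: "('a, 'b) ring_scheme"
  assumes "centrally_finite R" "unit_normal R N" "locally_radical R N"
  shows "N \<subseteq> ring_center R"
proof (rule ccontr)
  assume "\<not> N \<subseteq> ring_center R"
  then have "is_counterexample R" using assms unfolding is_counterexample_def by blast
  then have ce: "is_ce TYPE('a) TYPE('b)" unfolding is_ce_def by blast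
  define S where "S = (CE :: ('a, 'b) ring_scheme)"
  note [simp] = S_def[symmetric]
  note ops = to_ring_ops[OF ce, unfolded S_def[symmetric]]
    and inj = ce_true(3)[OF ce]
    and closed = ce_true(2)[OF ce, unfolded S_def[symmetric]]
    and of_ring = ce_true(4)[OF ce, unfolded S_def[symmetric]]
  obtain M where M: "unit_normal S M" "locally_radical S M" "\<not> M \<subseteq> ring_center S"
    using ce_true(1)[OF ce] by (auto simp: is_counterexample_def)
  interpret skew_field S
    using ce_true(1)[OF ce] by (simp add: is_counterexample_def centrally_finite_def)
  define P where "P = {x :: ('a, 'b) ce. to_ring x \<in> M}"
  have "P \<subseteq> cent"
  proof (rule radical_normal_central[OF ce_cent_finite[OF ce]])
    show "0 \<notin> P" using M(1) by (auto simp: P_def unit_normal_def ops)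
    show "x * y \<in> P" if "x \<in> P" "y \<in> P" for x y
      using that M(1) by (simp add: P_def unit_normal_def ops)
    have ne: "x \<noteq> 0" if "x \<in> P" for x using that M(1) by (auto simp: P_def unit_normal_def ops)
    show "inverse x \<in> P" if "x \<in> P" for x
    proof -
      have "to_ring x \<otimes>\<^bsub>S\<^esub> to_ring (inverse x) = \<one>\<^bsub>S\<^esub>"
        using right_inverse[OF ne[OF that]] ops(2,5) by metis
      then show ?thesis using that M(1) closed by (simp add: P_def unit_normal_def)
    qed
    show "u * x * inverse u \<in> P" if "u \<noteq> 0" "x \<in> P" for u x
    proof -
      have "to_ring u \<otimes>\<^bsub>S\<^esub> to_ring (inverse u) = \<one>\<^bsub>S\<^esub>"
        using right_inverse[OF that(1)] ops(2,5) by metis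
      then show ?thesis using that(2) M(1) closed by (simp add: P_def unit_normal_def ops(5))
    qed
    show "\<exists>n>0. x ^ n * d = d * x ^ n" if "x \<in> P" for x d
      using that M(2) closed[of d]
      by (auto simp: P_def locally_radical_def inj ops(5) to_ring_power[OF ce])
  qed
  moreover obtain p where p: "p \<in> M" "p \<notin> ring_center S" using M(3) by blast
  moreover have "p \<in> carrier S" using p(1) M(1) by (auto simp: unit_normal_def)
  moreover have "of_ring p \<in> P" unfolding P_def using of_ring[of p] p(1) \<open>p \<in> carrier S\<close> by simp
  ultimately show False
    using of_ring[of p] to_ring_cent[OF ce, of "of_ring p"] by auto
qed

section \<open>Reduction to centrally finite division rings\<close>

lemma division_subring_inverse:
  assumes "division_subring K D" "k \<in> K" "k \<noteq> \<zero>\<^bsub>D\<^esub>"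
  obtains h where "h \<in> K" "h \<otimes>\<^bsub>D\<^esub> k = \<one>\<^bsub>D\<^esub>" "k \<otimes>\<^bsub>D\<^esub> h = \<one>\<^bsub>D\<^esub>"
proof -
  have "skew_field (D\<lparr>carrier := K\<rparr>)" using assms(1) by (simp add: division_subring_def)
  then have "k \<in> Units (D\<lparr>carrier := K\<rparr>)" using assms(2,3) by (simp add: skew_field.skew_field_Units)
  then show ?thesis using that by (auto simp: Units_def)
qed

context skew_field
begin

lemma unit_normal_if_normal:
  assumes "N \<lhd> units_of R"
  shows "unit_normal R N"
proof -
  interpret U: group "units_of R" by (rule units_group)
  have sub: "subgroup N (units_of R)"
    and conj: "\<And>g x. g \<in> Units R \<Longrightarrow> x \<in> N \<Longrightarrow> g \<otimes> x \<otimes> inv g \<in> N"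
    using assms unfolding U.normal_inv_iff by (auto simp: units_of_carrier units_of_mult units_of_inv)
  have NU: "N \<subseteq> Units R" using subgroup.subset[OF sub] by (simp add: units_of_carrier)
  have inv: "y = inv x" if "x \<in> Units R" "y \<in> carrier R" "x \<otimes> y = \<one>" for x y
    using that by (metis Units_closed Units_inv_closed Units_l_inv m_assoc l_one r_one)
  show ?thesis
    unfolding unit_normal_def
  proof (intro conjI ballI impI)
    show "N \<subseteq> carrier R - {\<zero>}" using NU skew_field_Units by blast
    show "x \<otimes> y \<in> N" if "x \<in> N" "y \<in> N" for x y
      using subgroup.m_closed[OF sub that] by (simp add: units_of_mult)
    show "y \<in> N" if "x \<in> N" "y \<in> carrier R" "x \<otimes> y = \<one>" for x y
      using subgroup.m_inv_closed[OF sub that(1)] units_of_inv inv[of x y] that NU by auto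
    show "g \<otimes> x \<otimes> h \<in> N" if "x \<in> N" "g \<in> carrier R" "h \<in> carrier R" "g \<otimes> h = \<one>" for x g h
    proof -
      have "g \<noteq> \<zero>" using that(3,4) one_not_zero l_null by metis
      then have "g \<in> Units R" using that skew_field_Units by blast
      then show ?thesis using conj[OF _ that(1)] inv[of g h] that by simp
    qed
  qed
qed

lemma conj_pow:
  assumes "g \<in> carrier R" "h \<in> carrier R" "h \<otimes> g = \<one>" "x \<in> carrier R"
  shows "g \<otimes> x [^] n = (g \<otimes> x \<otimes> h) [^] (n::nat) \<otimes> g"
proof (induction n)
  case (Suc n)
  have "g \<otimes> x [^] Suc n = (g \<otimes> x [^] n) \<otimes> x" using assms by (simp add: m_assoc)
  also have "\<dots> = (g \<otimes> x \<otimes> h) [^] n \<otimes> (g \<otimes> x \<otimes> (h \<otimes> g))" using assms by (simp add: Suc m_assoc)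
  also have "\<dots> = (g \<otimes> x \<otimes> h) [^] Suc n \<otimes> g" using assms(1,2,4) by (simp add: m_assoc)
  finally show ?case .
qed (use assms in simp)

lemma pow_mult_mem:
  assumes "subring K R" "x \<in> carrier R" "x [^] (n::nat) \<in> K"
  shows "x [^] (n * m) \<in> K"
proof (induction m)
  case 0 show ?case using subringE(3)[OF assms(1)] by simp
next
  case (Suc m)
  have "x [^] (n * Suc m) = x [^] (n * m) \<otimes> x [^] n" using assms(2) by (simp add: nat_pow_mult add.commute)
  then show ?case using subringE(6)[OF assms(1) Suc assms(3)] by simp
qed

text \<open>Two conjugations, by $a$ and by $a + 1$, make the coefficients of a linear relation for $a$ over $K$;
for $a \notin K$ this relation has to be trivial.\<close>

lemma radical_imp_locally_radical:
  assumes K: "division_subring K R" "K \<noteq> carrier R"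
    and N: "unit_normal R N" and rad: "radical_over R N K"
  shows "locally_radical R N"
proof -
  have sub: "subring K R" using K(1) by (simp add: division_subring_def)
  note Kc = subringE(1)[OF sub]
  note K_closed = subringE(3,5,6,7)[OF sub]
  have N_c: "N \<subseteq> carrier R" using N by (auto simp: unit_normal_def)
  have outside: "\<exists>n::nat. n > 0 \<and> x [^] n \<otimes> a = a \<otimes> x [^] n"
    if x: "x \<in> N" and a: "a \<in> carrier R" "a \<notin> K" for x a
  proof -
    have xc: "x \<in> carrier R" using x N_c by blast
    have a1: "a \<oplus> \<one> \<noteq> \<zero>"
    proof
      assume "a \<oplus> \<one> = \<zero>"
      then have "a = \<ominus> \<one>" using a(1) minus_equality by simp
      then show False using a(2) K_closed(1,2) by simp
    qed
    have a0: "a \<noteq> \<zero>" using a(2) subringE(2)[OF sub] by blast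
    have unit: "\<exists>h\<in>carrier R. g \<otimes> h = \<one> \<and> h \<otimes> g = \<one>" if "g \<in> carrier R" "g \<noteq> \<zero>" for g
    proof -
      have "g \<in> Units R" using that skew_field_Units by blast
      then show ?thesis by (auto simp: Units_def)
    qed
    obtain h where h: "h \<in> carrier R" "a \<otimes> h = \<one>" "h \<otimes> a = \<one>" using unit a(1) a0 by blast
    obtain h' where h': "h' \<in> carrier R" "(a \<oplus> \<one>) \<otimes> h' = \<one>" "h' \<otimes> (a \<oplus> \<one>) = \<one>"
      using unit[of "a \<oplus> \<one>"] a(1) a1 by auto
    define y where "y = a \<otimes> x \<otimes> h"
    define z where "z = (a \<oplus> \<one>) \<otimes> x \<otimes> h'"
    have yN: "y \<in> N" "z \<in> N"
      using N x a(1) h h' unfolding unit_normal_def y_def z_def by simp_all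
    obtain n1 where n1: "n1 > 0" "x [^] (n1::nat) \<in> K" using rad x unfolding radical_over_def by blast
    obtain n2 where n2: "n2 > 0" "y [^] (n2::nat) \<in> K" using rad yN unfolding radical_over_def by blast
    obtain n3 where n3: "n3 > 0" "z [^] (n3::nat) \<in> K" using rad yN unfolding radical_over_def by blast
    define n where "n = n1 * n2 * n3"
    have "x [^] n \<in> K" using pow_mult_mem[OF sub xc n1(2), of "n2 * n3"] by (simp add: n_def mult.assoc)
    moreover have "y [^] n \<in> K"
      using pow_mult_mem[OF sub _ n2(2), of "n1 * n3"] yN N_c by (auto simp: n_def mult_ac)
    moreover have "z [^] n \<in> K"
      using pow_mult_mem[OF sub _ n3(2), of "n1 * n2"] yN N_c by (auto simp: n_def mult_ac)
    ultimately obtain X Y Z where XYZ: "X = x [^] n" "Y = y [^] n" "Z = z [^] n"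
      and inK: "X \<in> K" "Y \<in> K" "Z \<in> K" by blast
    have c: "X \<in> carrier R" "Y \<in> carrier R" "Z \<in> carrier R" using inK Kc by auto
    have aX: "a \<otimes> X = Y \<otimes> a"
      unfolding XYZ y_def by (rule conj_pow) (use a(1) h xc in auto)
    have "(a \<oplus> \<one>) \<otimes> X = Z \<otimes> (a \<oplus> \<one>)"
      unfolding XYZ z_def by (rule conj_pow) (use a(1) h' xc in auto)
    then have eq: "Y \<otimes> a \<oplus> X = Z \<otimes> a \<oplus> Z"
      using a(1) c by (simp add: l_distr r_distr aX)
    have "Y = Z"
    proof (rule ccontr)
      assume "Y \<noteq> Z"
      then have "Y \<ominus> Z \<noteq> \<zero>" using c r_right_minus_eq by blast
      moreover have d: "Y \<ominus> Z \<in> K" using inK K_closed by (simp add: a_minus_def)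
      ultimately obtain i where i: "i \<in> K" "i \<otimes> (Y \<ominus> Z) = \<one>"
        using division_subring_inverse[OF K(1)] by blast
      have ic: "i \<in> carrier R" using i(1) Kc by blast
      have "(Y \<ominus> Z) \<otimes> a = Z \<ominus> X"
      proof -
        define p q where "p = Y \<otimes> a" and "q = Z \<otimes> a"
        have pq: "p \<in> carrier R" "q \<in> carrier R" using a(1) c by (simp_all add: p_def q_def)
        have "(q \<oplus> (Z \<ominus> X)) \<oplus> X = q \<oplus> Z"
          using pq c by (simp add: a_minus_def a_assoc l_neg)
        then have "p \<oplus> X = (q \<oplus> (Z \<ominus> X)) \<oplus> X" using eq by (simp add: p_def q_def)
        then have "p = q \<oplus> (Z \<ominus> X)" using pq c by simp
        then have "p \<ominus> q = (Z \<ominus> X) \<oplus> q \<ominus> q" using pq c by (simp add: a_comm)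
        also have "\<dots> = Z \<ominus> X" using pq c by (simp add: a_minus_def a_assoc r_neg)
        finally have "p \<ominus> q = Z \<ominus> X" .
        then show ?thesis using a(1) c by (simp add: p_def q_def a_minus_def l_distr l_minus)
      qed
      then have "i \<otimes> ((Y \<ominus> Z) \<otimes> a) = i \<otimes> (Z \<ominus> X)" by simp
      then have "a = i \<otimes> (Z \<ominus> X)"
        using i(2) ic a(1) c by (simp add: m_assoc[symmetric])
      moreover have "i \<otimes> (Z \<ominus> X) \<in> K" using i(1) inK K_closed by (simp add: a_minus_def)
      ultimately show False using a(2) by simp
    qed
    then have "X = Y" using eq a(1) c by simp
    then have "X \<otimes> a = a \<otimes> X" using aX by simp
    moreover have "n > 0" using n1 n2 n3 by (simp add: n_def)
    ultimately show ?thesis unfolding XYZ(1) by blast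
  qed
  have "\<exists>n::nat. n > 0 \<and> x [^] n \<otimes> d = d \<otimes> x [^] n" if x: "x \<in> N" and d: "d \<in> carrier R" for x d
  proof (cases "d \<in> K")
    case False then show ?thesis using outside x d by blast
  next
    case True
    have xc: "x \<in> carrier R" using x N_c by blast
    obtain b where b: "b \<in> carrier R" "b \<notin> K" using K Kc by blast
    have bd: "b \<oplus> d \<notin> K"
    proof
      assume "b \<oplus> d \<in> K"
      then have "(b \<oplus> d) \<oplus> (\<ominus> d) \<in> K" using True K_closed by simp
      then show False using b d by (simp add: a_assoc r_neg)
    qed
    obtain n where n: "n > 0" "x [^] (n::nat) \<otimes> b = b \<otimes> x [^] n" using outside[OF x b] by blast
    obtain m where m: "m > 0" "x [^] (m::nat) \<otimes> (b \<oplus> d) = (b \<oplus> d) \<otimes> x [^] m"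
      using outside[OF x _ bd] b(1) d by auto
    define X where "X = x [^] (n * m)"
    have X: "X \<in> carrier R" using xc by (simp add: X_def)
    have 1: "X \<otimes> b = b \<otimes> X"
      unfolding X_def nat_pow_pow[OF xc, symmetric]
      by (rule group_commutes_pow[OF n(2)]) (use xc b in auto)
    have 2: "X \<otimes> (b \<oplus> d) = (b \<oplus> d) \<otimes> X"
      unfolding X_def mult.commute[of n] nat_pow_pow[OF xc, symmetric]
      by (rule group_commutes_pow[OF m(2)]) (use xc b d in auto)
    have "X \<otimes> b \<oplus> X \<otimes> d = X \<otimes> b \<oplus> d \<otimes> X"
      using 1 2 X b(1) d by (simp add: l_distr r_distr)
    then have "X \<otimes> d = d \<otimes> X" using X b(1) d by simp
    then show ?thesis using n(1) m(1) unfolding X_def by (intro exI[of _ "n * m"]) simp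
  qed
  then show ?thesis unfolding locally_radical_def by blast
qed

end

theorem mainTheorem1:
  fixes D :: "('a, 'b) ring_scheme" and K N :: "'a set"
  assumes "skew_field D" and "\<not> cring D"
    and "division_subring K D" and "K \<noteq> carrier D" and "ring_center D \<subseteq> K"
    and "N \<lhd> units_of D"
    and "radical_over D N K"
  shows "\<not> (\<exists>x \<in> N - K. kurosh D x)"
proof
  assume "\<exists>x \<in> N - K. kurosh D x"
  then obtain x D1 where x: "x \<in> N" "x \<in> D1"
    and D1: "division_subring D1 D" "centrally_finite (D\<lparr>carrier := D1\<rparr>)"
    and nc: "x \<notin> ring_center (D\<lparr>carrier := D1\<rparr>)"
    by (auto simp: kurosh_def)
  interpret skew_field D by fact
  have N: "unit_normal D N" using unit_normal_if_normal assms(6) .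
  have loc: "locally_radical D N"
    using radical_imp_locally_radical[OF assms(3,4) N assms(7)] .
  have sub: "subring D1 D" using D1(1) by (simp add: division_subring_def)
  have D1c: "D1 \<subseteq> carrier D" using subringE(1)[OF sub] .
  have "unit_normal (D\<lparr>carrier := D1\<rparr>) (N \<inter> D1)"
    unfolding unit_normal_def
  proof (intro conjI ballI impI)
    show "N \<inter> D1 \<subseteq> carrier (D\<lparr>carrier := D1\<rparr>) - {\<zero>\<^bsub>D\<lparr>carrier := D1\<rparr>\<^esub>}"
      using N by (auto simp: unit_normal_def)
    fix x assume x: "x \<in> N \<inter> D1"
    show "x \<otimes>\<^bsub>D\<lparr>carrier := D1\<rparr>\<^esub> y \<in> N \<inter> D1" if "y \<in> N \<inter> D1" for y
      using N x that subringE(6)[OF sub] by (simp add: unit_normal_def)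
    show "y \<in> N \<inter> D1" if "y \<in> carrier (D\<lparr>carrier := D1\<rparr>)"
      "x \<otimes>\<^bsub>D\<lparr>carrier := D1\<rparr>\<^esub> y = \<one>\<^bsub>D\<lparr>carrier := D1\<rparr>\<^esub>" for y
      using N x that D1c by (auto simp: unit_normal_def)
    show "g \<otimes>\<^bsub>D\<lparr>carrier := D1\<rparr>\<^esub> x \<otimes>\<^bsub>D\<lparr>carrier := D1\<rparr>\<^esub> h \<in> N \<inter> D1"
      if "g \<in> carrier (D\<lparr>carrier := D1\<rparr>)" "h \<in> carrier (D\<lparr>carrier := D1\<rparr>)"
        "g \<otimes>\<^bsub>D\<lparr>carrier := D1\<rparr>\<^esub> h = \<one>\<^bsub>D\<lparr>carrier := D1\<rparr>\<^esub>" for g h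
    proof -
      have gh: "g \<in> D1" "h \<in> D1" "g \<otimes>\<^bsub>D\<^esub> h = \<one>\<^bsub>D\<^esub>" using that by simp_all
      have "g \<otimes>\<^bsub>D\<^esub> x \<otimes>\<^bsub>D\<^esub> h \<in> N"
        using N x gh D1c unfolding unit_normal_def by blast
      then show ?thesis using x gh subringE(6)[OF sub] by simp
    qed
  qed
  moreover have "y [^]\<^bsub>D\<lparr>carrier := D1\<rparr>\<^esub> (n::nat) = y [^]\<^bsub>D\<^esub> n" for y n
    by (simp add: nat_pow_def)
  then have "locally_radical (D\<lparr>carrier := D1\<rparr>) (N \<inter> D1)"
    using loc D1c unfolding locally_radical_def by auto
  ultimately have "N \<inter> D1 \<subseteq> ring_center (D\<lparr>carrier := D1\<rparr>)"
    using centrally_finite_radical[OF D1(2)] by blast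
  then show False using x nc by blast
qed

end
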